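(* Let $X$ be a complex Banach space and suppose that $T\in B(X)$ is a left invertible and Fredholm bounded linear operator. Then $$\operatorname{dist}(0,\sigma_\ell(T))=\sup\Big\{\frac{1}{r(S)} : S\in B(X),\ ST=I\Big\},$$ where $r(S)$ denotes the spectral radius of $S$.
   Context: $B(X)$ is the algebra of bounded linear operators on the complex Banach space $X$ and $I$ is the identity. $T$ is Fredholm if its range is closed and both its kernel dimension and the codimension of its range are finite. $T$ is left invertible if there is $S\in B(X)$ with $ST=I$. $\rho_\ell(T)$ is the set of all $\lambda\in\mathbb{C}$ such that $T-\lambda I$ is left invertible, and $\sigma_\ell(T)=\mathbb{C}\setminus\rho_\ell(T)$ is the left spectrum. Conventions: $1/0=\infty$ and $\operatorname{dist}(0,\emptyset)=\infty$. *)

theory Defs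
  imports "HOL-Analysis.Analysis"
begin

class scaleC =
  fixes scaleC :: "complex \<Rightarrow> 'a \<Rightarrow> 'a"  (infixr "*\<^sub>C" 75)

text \<open>A complex normed space is a real normed space whose scalar multiplication is the
  restriction of a complex one, with the norm homogeneous over the complex numbers.\<close>

class complex_normed_vector = real_normed_vector + scaleC +
  assumes scaleC_add_right: "c *\<^sub>C (x + y) = c *\<^sub>C x + c *\<^sub>C y"
    and scaleC_add_left: "(c + d) *\<^sub>C x = c *\<^sub>C x + d *\<^sub>C x"
    and scaleC_scaleC: "c *\<^sub>C d *\<^sub>C x = (c * d) *\<^sub>C x"
    and scaleC_one: "1 *\<^sub>C x = x"
    and scaleR_scaleC: "r *\<^sub>R x = complex_of_real r *\<^sub>C x"
    and norm_scaleC: "norm (c *\<^sub>C x) = cmod c * norm x"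

class cbanach = complex_normed_vector + banach

global_interpretation complex_vector: vector_space "scaleC :: complex \<Rightarrow> 'a \<Rightarrow> 'a::complex_normed_vector"
  defines cspan = complex_vector.span
  by unfold_locales (simp_all add: scaleC_add_right scaleC_add_left scaleC_scaleC scaleC_one)

definition bounded_clinear :: "('a::complex_normed_vector \<Rightarrow> 'a) \<Rightarrow> bool" where
  "bounded_clinear T \<longleftrightarrow> bounded_linear T \<and> (\<forall>c x. T (c *\<^sub>C x) = c *\<^sub>C T x)"

text \<open>The second conjunct says that the kernel is spanned by finitely many vectors; the third that
  the quotient of the space by the range is spanned by the cosets of finitely many vectors.\<close>

definition fredholm :: "('a::complex_normed_vector \<Rightarrow> 'a) \<Rightarrow> bool" where
  "fredholm T \<longleftrightarrow> closed (range T)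
     \<and> (\<exists>B. finite B \<and> cspan B = {x. T x = 0})
     \<and> (\<exists>B. finite B \<and> (\<forall>x. \<exists>b \<in> cspan B. x - b \<in> range T))"

definition left_invertible :: "('a::complex_normed_vector \<Rightarrow> 'a) \<Rightarrow> bool" where
  "left_invertible T \<longleftrightarrow> (\<exists>S. bounded_clinear S \<and> S \<circ> T = id)"

definition invertible_op :: "('a::complex_normed_vector \<Rightarrow> 'a) \<Rightarrow> bool" where
  "invertible_op T \<longleftrightarrow> (\<exists>S. bounded_clinear S \<and> S \<circ> T = id \<and> T \<circ> S = id)"

definition left_resolvent_set :: "('a::complex_normed_vector \<Rightarrow> 'a) \<Rightarrow> complex set" where
  "left_resolvent_set T = {c. left_invertible (\<lambda>x. T x - c *\<^sub>C x)}"

definition left_spectrum :: "('a::complex_normed_vector \<Rightarrow> 'a) \<Rightarrow> complex set" where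
  "left_spectrum T = - left_resolvent_set T"

definition spectrum :: "('a::complex_normed_vector \<Rightarrow> 'a) \<Rightarrow> complex set" where
  "spectrum T = {c. \<not> invertible_op (\<lambda>x. T x - c *\<^sub>C x)}"

text \<open>Values are taken in \<^typ>\<open>ennreal\<close>. There the supremum of the empty set is \<open>0\<close>, so the
  zero operator on the zero space, whose spectrum is empty, has spectral radius \<open>0\<close>;
  moreover \<open>1 / 0 = \<infinity>\<close>.\<close>

definition spectral_radius :: "('a::complex_normed_vector \<Rightarrow> 'a) \<Rightarrow> ennreal" where
  "spectral_radius T = (SUP c \<in> spectrum T. ennreal (cmod c))"

text \<open>Unlike \<^const>\<open>infdist\<close>, the distance to the empty set is \<open>\<infinity>\<close>.\<close>

definition set_edist :: "'b::metric_space \<Rightarrow> 'b set \<Rightarrow> ennreal" where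
  "set_edist z A = (INF w \<in> A. ennreal (dist z w))"

end

theory Submission
  imports Defs "HOL-Complex_Analysis.Complex_Analysis" "Jordan_Normal_Form.Determinant"
begin

text \<open>
  If \<open>S\<close> is a left inverse of \<open>T\<close> then \<open>S (T - c) = I - c S\<close>, so \<open>T - c\<close> is left invertible
  whenever \<open>\<bar>c\<bar> r(S) < 1\<close>; this is one inequality. For the other, let \<open>T - c\<close> be left invertible on
  a disc \<open>D\<close> around \<open>0\<close>. Since the defect \<open>I - T S\<close> has finite rank, a connectedness argument shows
  that \<open>I - c S\<close> is a finite rank perturbation of an invertible operator for every \<open>c\<close> in \<open>D\<close>. By
  the analytic Fredholm theorem it fails to be injective only at isolated points, each of
  finite algebraic multiplicity. If \<open>e = c S e\<close> with \<open>e \<noteq> 0\<close>, then injectivity of \<open>T - c\<close> gives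
  \<open>(I - T S) e \<noteq> 0\<close>, so there is a functional \<open>f\<close> with \<open>f T = 0\<close> and \<open>f e = - 1 / c\<close>; then
  \<open>S + f(_) e\<close> is again a left inverse of \<open>T\<close>, and the multiplicity at \<open>c\<close> has dropped by one.
  After finitely many steps no bad point is left in a given smaller closed disc.
\<close>

subsection \<open>Holomorphic matrix families\<close>

text \<open>Injectivity of \<open>I - c S\<close> does not by itself give invertibility; index zero
  supplies the missing half. The index is never defined: "index zero" means that adding some finite
  rank operator makes the operator invertible. This is trivial at \<open>c = 0\<close>. Because
  \<open>S (T - c) = I - c S\<close>, it propagates along connected sets where \<open>T - c\<close>
  is left invertible, although no left inverse is chosen continuously in \<open>c\<close>.

  The meromorphic inverse of \<open>I - z S\<close> is replaced by a lower bound
  \<open>k * |z - c| ^ p * norm x \<le> norm (x - z S x)\<close> near each \<open>c\<close>. Off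
  \<open>c\<close> the factor is positive, which isolates the bad points; the exponent
  \<open>p\<close> limits the length of Jordan chains. No contour integrals or Riesz projections are
  needed.

  The value \<open>f e = - 1 / c\<close> is forced by \<open>S e = e / c\<close>: the new operator
  then annihilates \<open>e\<close>. The condition \<open>f T = 0\<close> keeps it a left inverse.
  The bounds hold only inside \<open>D\<close>, so bad points are counted on a compact
  subdisc.\<close>

lemma holomorphic_on_det:
  fixes A :: "complex \<Rightarrow> complex mat"
  assumes "\<And>z. A z \<in> carrier_mat n n"
    and "\<And>i j. i < n \<Longrightarrow> j < n \<Longrightarrow> (\<lambda>z. A z $$ (i, j)) holomorphic_on S"
  shows "(\<lambda>z. Determinant.det (A z)) holomorphic_on S"
proof -
  have "(\<lambda>z. \<Sum>p | p permutes {0..<n}. of_int (sign p) * (\<Prod>i = 0..<n. A z $$ (i, p i)))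
      holomorphic_on S"
  proof (intro holomorphic_intros)
    fix p i assume "p \<in> {p. p permutes {0..<n}}" "i \<in> {0..<n}"
    then have "p i < n" "i < n"
      using permutes_in_image[of p "{0..<n}" i] by auto
    then show "(\<lambda>z. A z $$ (i, p i)) holomorphic_on S" by (intro assms(2))
  qed
  then show ?thesis by (simp add: Determinant.det_def'[OF assms(1)])
qed

lemma matrix_scalar_product_apply:
  fixes a b :: "nat \<Rightarrow> nat \<Rightarrow> 'b::comm_ring_1"
  assumes "\<And>i k. i < m \<Longrightarrow> k < m \<Longrightarrow> (\<Sum>j<m. b i j * a j k) = (if i = k then h else 0)"
    and "i < m"
  shows "(\<Sum>j<m. b i j * (\<Sum>k<m. a j k * c k)) = h * c i"
proof -
  have "(\<Sum>j<m. b i j * (\<Sum>k<m. a j k * c k)) = (\<Sum>j<m. \<Sum>k<m. b i j * a j k * c k)"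
    by (simp add: sum_distrib_left mult.assoc)
  also have "\<dots> = (\<Sum>k<m. \<Sum>j<m. b i j * a j k * c k)" by (rule sum.swap)
  also have "\<dots> = (\<Sum>k<m. (if i = k then h else 0) * c k)"
    using assms by (simp add: sum_distrib_right[symmetric])
  also have "\<dots> = (\<Sum>k<m. if i = k then h * c k else 0)" by (rule sum.cong) auto
  also have "\<dots> = h * c i" using assms(2) by simp
  finally show ?thesis .
qed

text \<open>The witnesses are the determinant \<open>h\<close> and the adjugate \<open>b\<close>.
  Unlike the inverse, the adjugate is polynomial in the entries, so it stays holomorphic where the
  matrix degenerates, and Cramer's rule holds there without division.\<close>

lemma holomorphic_adjugate:
  fixes a :: "nat \<Rightarrow> nat \<Rightarrow> complex \<Rightarrow> complex"
  assumes hol: "\<forall>i<m. \<forall>j<m. a i j holomorphic_on S"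
  shows "\<exists>h b. h holomorphic_on S \<and> (\<forall>i<m. \<forall>j<m. b i j holomorphic_on S)
    \<and> (\<forall>z c. \<forall>i<m. (\<Sum>j<m. b i j z * (\<Sum>k<m. a j k z * c k)) = h z * c i)
    \<and> (\<forall>z c. \<forall>i<m. (\<Sum>j<m. a i j z * (\<Sum>k<m. b j k z * c k)) = h z * c i)
    \<and> (\<forall>z. h z = 0 \<longrightarrow> (\<exists>c. (\<exists>i<m. c i \<noteq> 0) \<and> (\<forall>i<m. (\<Sum>j<m. a i j z * c j) = 0)))"
proof -
  define A where "A = (\<lambda>z. Matrix.mat m m (\<lambda>(i, j). a i j z))"
  have A: "A z \<in> carrier_mat m m" for z by (simp add: A_def)
  define h where "h = (\<lambda>z. Determinant.det (A z))"
  define b where "b = (\<lambda>i j z. adj_mat (A z) $$ (i, j))"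
  have adj: "adj_mat (A z) \<in> carrier_mat m m" for z using adj_mat(1)[OF A] .
  have h: "h holomorphic_on S" unfolding h_def
    by (rule holomorphic_on_det[of _ m]) (use hol in \<open>auto simp: A_def\<close>)
  have b: "b i j holomorphic_on S" if "i < m" "j < m" for i j
  proof -
    have "(\<lambda>z. Determinant.det (mat_delete (A z) j i)) holomorphic_on S"
    proof (rule holomorphic_on_det[of _ "m - 1"])
      show "mat_delete (A z) j i \<in> carrier_mat (m - 1) (m - 1)" for z
        by (rule mat_delete_carrier[OF A])
      fix i' j' assume "i' < m - 1" "j' < m - 1"
      then show "(\<lambda>z. mat_delete (A z) j i $$ (i', j')) holomorphic_on S"
        using hol that by (auto simp: A_def mat_delete_def)
    qed
    then have "(\<lambda>z. (- 1) ^ (j + i) * Determinant.det (mat_delete (A z) j i)) holomorphic_on S"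
      by (intro holomorphic_intros)
    moreover have "b i j = (\<lambda>z. (- 1) ^ (j + i) * Determinant.det (mat_delete (A z) j i))"
      using that A by (auto simp: b_def adj_mat_def cofactor_def A_def)
    ultimately show ?thesis by simp
  qed
  have ba: "(\<Sum>j<m. b i j z * a j k z) = (if i = k then h z else 0)" if "i < m" "k < m" for i k z
  proof -
    have "(adj_mat (A z) * A z) $$ (i, k) = (h z \<cdot>\<^sub>m 1\<^sub>m m) $$ (i, k)"
      by (simp add: h_def adj_mat(3)[OF A])
    then show ?thesis using that adj[of z]
      by (auto simp: scalar_prod_def b_def A_def atLeast0LessThan)
  qed
  have ab: "(\<Sum>j<m. a i j z * b j k z) = (if i = k then h z else 0)" if "i < m" "k < m" for i k z
  proof -
    have "(A z * adj_mat (A z)) $$ (i, k) = (h z \<cdot>\<^sub>m 1\<^sub>m m) $$ (i, k)"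
      by (simp add: h_def adj_mat(2)[OF A])
    then show ?thesis using that adj[of z]
      by (auto simp: scalar_prod_def b_def A_def atLeast0LessThan)
  qed
  show ?thesis
  proof (intro exI[of _ h] exI[of _ b] conjI allI impI)
    show "h holomorphic_on S" by (rule h)
    show "b i j holomorphic_on S" if "i < m" "j < m" for i j using that by (rule b)
    show "(\<Sum>j<m. b i j z * (\<Sum>k<m. a j k z * c k)) = h z * c i" if "i < m" for z c i
      by (rule matrix_scalar_product_apply[OF ba that])
    show "(\<Sum>j<m. a i j z * (\<Sum>k<m. b j k z * c k)) = h z * c i" if "i < m" for z c i
      by (rule matrix_scalar_product_apply[OF ab that])
    fix z assume "h z = 0"
    then obtain v where v: "v \<in> carrier_vec m" "v \<noteq> 0\<^sub>v m" "A z *\<^sub>v v = 0\<^sub>v m"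
      using det_0_iff_vec_prod_zero[OF A, of z] by (auto simp: h_def)
    show "\<exists>c. (\<exists>i<m. c i \<noteq> 0) \<and> (\<forall>i<m. (\<Sum>j<m. a i j z * c j) = 0)"
    proof (intro exI[of _ "vec_index v"] conjI allI impI)
      show "\<exists>i<m. vec_index v i \<noteq> 0"
      proof (rule ccontr)
        assume "\<not> (\<exists>i<m. vec_index v i \<noteq> 0)"
        then have "v = 0\<^sub>v m" using v(1) by (intro eq_vecI) auto
        then show False using v(2) by simp
      qed
      fix i assume "i < m"
      then have "vec_index (A z *\<^sub>v v) i = 0" using v by simp
      then show "(\<Sum>j<m. a i j z * vec_index v j) = 0"
        using \<open>i < m\<close> v(1) by (auto simp: A_def scalar_prod_def atLeast0LessThan)
    qed
  qed
qed

text \<open>Near \<open>w\<close> one factors \<open>h z = (z - w) ^ n * g z\<close> with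
  \<open>g\<close> free of zeros. The exponent \<open>p\<close> is the order \<open>n\<close> (which
  is \<open>0\<close> if \<open>h w\<close> is nonzero), and \<open>k\<close> is the minimum of
  \<open>|g|\<close> on the closed disc of half the radius.\<close>

lemma holomorphic_zero_order_bound:
  assumes hol: "h holomorphic_on S" and S: "open S" "connected S" and w: "w \<in> S"
    and nz: "\<exists>z\<in>S. h z \<noteq> 0"
  shows "\<exists>(p::nat) k e. k > 0 \<and> e > 0 \<and> (\<forall>z. dist z w < e \<longrightarrow> k * cmod (z - w) ^ p \<le> cmod (h z))"
proof -
  obtain g r n where r: "0 < r" "ball w r \<subseteq> S" and g: "g holomorphic_on ball w r"
    and eq: "\<And>z. z \<in> ball w r \<Longrightarrow> h z = (z - w) ^ n * g z"
    and gnz: "\<And>z. z \<in> ball w r \<Longrightarrow> g z \<noteq> 0"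
  proof (cases "h w = 0")
    case True
    obtain z where "z \<in> S" "h z \<noteq> h w" using nz True by auto
    then have "\<not> h constant_on S" using w unfolding constant_on_def by metis
    show ?thesis
      by (rule holomorphic_factor_zero_nonconstant[OF hol S w True \<open>\<not> h constant_on S\<close>])
        (rule that)
  next
    case False
    have "continuous (at w) h"
      using hol S w by (metis continuous_on_eq_continuous_at holomorphic_on_imp_continuous_on)
    from continuous_at_avoid[OF this False] obtain e1 where e1: "e1 > 0"
      "\<And>y. dist w y < e1 \<Longrightarrow> h y \<noteq> 0" by blast
    obtain e2 where e2: "e2 > 0" "ball w e2 \<subseteq> S" using S w open_contains_ball by blast
    have sub: "ball w (min e1 e2) \<subseteq> S" using e2(2) by auto
    show ?thesis
      by (rule that[of "min e1 e2" h 0])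
        (use e1 e2 sub holomorphic_on_subset[OF hol sub] in auto)
  qed
  have "continuous_on (cball w (r/2)) g"
    by (rule continuous_on_subset[OF holomorphic_on_imp_continuous_on[OF g]]) (use r in auto)
  then have "continuous_on (cball w (r/2)) (\<lambda>z. cmod (g z))" by (intro continuous_intros)
  then obtain z0 where z0: "z0 \<in> cball w (r/2)" "\<And>z. z \<in> cball w (r/2) \<Longrightarrow> cmod (g z0) \<le> cmod (g z)"
    using continuous_attains_inf[of "cball w (r/2)" "\<lambda>z. cmod (g z)"] r
      compact_cball[of w "r/2"] centre_in_cball[of w "r/2"] by (metis empty_iff half_gt_zero less_imp_le)
  show ?thesis
  proof (rule exI[of _ n], rule exI[of _ "cmod (g z0)"], rule exI[of _ "r/2"], intro conjI allI impI)
    show "cmod (g z0) > 0" using gnz[of z0] z0(1) r by auto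
    show "r/2 > 0" using r by simp
    fix z assume "dist z w < r/2"
    then have "z \<in> cball w (r/2)" "z \<in> ball w r" using r by (auto simp: dist_commute)
    then show "cmod (g z0) * cmod (z - w) ^ n \<le> cmod (h z)"
      using mult_left_mono[OF z0(2), of z "cmod (z - w) ^ n"] eq[of z]
      by (simp add: norm_mult norm_power mult.commute)
  qed
qed

subsection \<open>Bounded operators and finite rank operators\<close>

lemma bounded_clinearD:
  assumes "bounded_clinear A"
  shows "bounded_linear A" "A (x + y) = A x + A y" "A (x - y) = A x - A y" "A (c *\<^sub>C x) = c *\<^sub>C A x"
    "A 0 = 0" "A (- x) = - A x" "A (sum f I) = (\<Sum>i\<in>I. A (f i))"
proof -
  show bl: "bounded_linear A" using assms by (simp add: bounded_clinear_def)
  then interpret bounded_linear A .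
  show "A (x + y) = A x + A y" "A (x - y) = A x - A y" "A 0 = 0" "A (- x) = - A x"
    "A (sum f I) = (\<Sum>i\<in>I. A (f i))"
    by (simp_all add: add diff zero neg sum)
  show "A (c *\<^sub>C x) = c *\<^sub>C A x" using assms by (simp add: bounded_clinear_def)
qed

lemma bounded_clinear_bound:
  assumes "bounded_clinear A"
  obtains K where "K > 0" "\<And>x. norm (A x) \<le> K * norm x"
proof -
  obtain K where "K > 0" "\<And>x. norm (A x) \<le> norm x * K"
    using bounded_linear.pos_bounded[OF bounded_clinearD(1)[OF assms]] by blast
  then show ?thesis using that[of K] by (simp add: mult.commute)
qed

lemma bounded_clinear_intro:
  assumes "\<And>x y. A (x + y) = A x + A y" "\<And>c x. A (c *\<^sub>C x) = c *\<^sub>C A x"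
    "\<And>x. norm (A x) \<le> K * norm x"
  shows "bounded_clinear A"
  unfolding bounded_clinear_def
proof (intro conjI allI)
  show "bounded_linear A"
    by (rule bounded_linear_intro[of _ K]) (use assms in \<open>auto simp: scaleR_scaleC mult.commute\<close>)
qed (rule assms)

lemma bounded_clinear_ident: "bounded_clinear (\<lambda>x. x)"
  by (rule bounded_clinear_intro[of _ 1]) auto

lemma bounded_clinear_compose: "bounded_clinear A \<Longrightarrow> bounded_clinear B \<Longrightarrow> bounded_clinear (\<lambda>x. A (B x))"
  unfolding bounded_clinear_def by (auto intro: bounded_linear_compose)

lemma bounded_clinear_add: "bounded_clinear A \<Longrightarrow> bounded_clinear B \<Longrightarrow> bounded_clinear (\<lambda>x. A x + B x)"
  unfolding bounded_clinear_def by (auto intro: bounded_linear_add simp: scaleC_add_right)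

lemma bounded_clinear_diff: "bounded_clinear A \<Longrightarrow> bounded_clinear B \<Longrightarrow> bounded_clinear (\<lambda>x. A x - B x)"
  unfolding bounded_clinear_def by (auto intro: bounded_linear_sub simp: complex_vector.scale_right_diff_distrib)

lemma bounded_clinear_scale: 
  assumes "bounded_clinear A" shows "bounded_clinear (\<lambda>x. c *\<^sub>C A x)"
proof -
  obtain K where K: "K > 0" "\<And>x. norm (A x) \<le> K * norm x" using bounded_clinear_bound[OF assms] by blast
  have "norm (c *\<^sub>C A x) \<le> cmod c * K * norm x" for x
    using mult_left_mono[OF K(2)[of x] norm_ge_zero[of c]] by (simp add: norm_scaleC mult.assoc)
  then show ?thesis
    by (rule bounded_clinear_intro[rotated 2])
      (simp_all add: bounded_clinearD(2,4)[OF assms] scaleC_add_right scaleC_scaleC mult.commute)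
qed

lemmas bounded_clinear_intros = bounded_clinear_ident bounded_clinear_add bounded_clinear_diff
  bounded_clinear_scale

text \<open>\<open>bounded_clinear\<close> covers only maps of a space into itself, so scalar-valued
  maps need a predicate of their own.\<close>

definition bounded_cfunctional :: "('a::complex_normed_vector \<Rightarrow> complex) \<Rightarrow> bool" where
  "bounded_cfunctional f \<longleftrightarrow> bounded_linear f \<and> (\<forall>c x. f (c *\<^sub>C x) = c * f x)"

lemma bounded_cfunctionalD:
  assumes "bounded_cfunctional f"
  shows "bounded_linear f" "f (x + y) = f x + f y" "f (x - y) = f x - f y" "f (c *\<^sub>C x) = c * f x"
    "f 0 = 0" "f (sum g I) = (\<Sum>i\<in>I. f (g i))"
proof -
  show bl: "bounded_linear f" using assms by (simp add: bounded_cfunctional_def)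
  then interpret bounded_linear f .
  show "f (x + y) = f x + f y" "f (x - y) = f x - f y" "f 0 = 0"
    "f (sum g I) = (\<Sum>i\<in>I. f (g i))"
    by (simp_all add: add diff zero sum)
  show "f (c *\<^sub>C x) = c * f x" using assms by (simp add: bounded_cfunctional_def)
qed

lemma bounded_cfunctional_bound:
  assumes "bounded_cfunctional f"
  obtains K where "K > 0" "\<And>x. cmod (f x) \<le> K * norm x"
proof -
  obtain K where "K > 0" "\<And>x. norm (f x) \<le> norm x * K"
    using bounded_linear.pos_bounded[OF bounded_cfunctionalD(1)[OF assms]] by blast
  then show ?thesis using that[of K] by (simp add: mult.commute)
qed

lemma bounded_cfunctional_compose:
  "bounded_cfunctional f \<Longrightarrow> bounded_clinear A \<Longrightarrow> bounded_cfunctional (\<lambda>x. f (A x))"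
  unfolding bounded_cfunctional_def bounded_clinear_def by (auto intro: bounded_linear_compose)

lemma bounded_cfunctional_intro:
  assumes "\<And>x y. f (x + y) = f x + f y" "\<And>c x. f (c *\<^sub>C x) = c * f x"
    "\<And>x. cmod (f x) \<le> K * norm x"
  shows "bounded_cfunctional f"
  unfolding bounded_cfunctional_def
proof (intro conjI allI)
  show "bounded_linear f"
    by (rule bounded_linear_intro[of _ K])
      (use assms in \<open>auto simp: scaleR_scaleC mult.commute scaleR_conv_of_real\<close>)
qed (rule assms)

lemma bounded_cfunctional_scale:
  assumes "bounded_cfunctional f" shows "bounded_cfunctional (\<lambda>x. c * f x)"
  using assms unfolding bounded_cfunctional_def
  by (auto intro: bounded_linear_const_mult)

lemma bounded_cfunctional_sum:
  assumes "\<And>i. i \<in> I \<Longrightarrow> bounded_cfunctional (f i)"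
  shows "bounded_cfunctional (\<lambda>x. \<Sum>i\<in>I. f i x)"
  using assms unfolding bounded_cfunctional_def
  by (auto intro: bounded_linear_sum simp: sum_distrib_left intro!: sum.cong)

lemma bounded_clinear_rank_one:
  assumes "bounded_cfunctional f" shows "bounded_clinear (\<lambda>x. f x *\<^sub>C u)"
proof -
  obtain K where K: "K > 0" "\<And>x. cmod (f x) \<le> K * norm x" using bounded_cfunctional_bound[OF assms] by blast
  show ?thesis
  proof (rule bounded_clinear_intro[of _ "K * norm u"])
    show "norm (f x *\<^sub>C u) \<le> K * norm u * norm x" for x
      using mult_right_mono[OF K(2)[of x], of "norm u"] by (simp add: norm_scaleC mult_ac)
  qed (simp_all add: bounded_cfunctionalD[OF assms] scaleC_add_left scaleC_scaleC)
qed

text \<open>Sums of rank one operators with bounded functionals: boundedness is built in, and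
  closure properties follow by induction. \<open>finite_rank_if_range_finite\<close> recovers, on a
  Banach space, the bounded operators with finite-dimensional range.\<close>

inductive finite_rank :: "('a::complex_normed_vector \<Rightarrow> 'a) \<Rightarrow> bool" where
  zero: "finite_rank (\<lambda>x. 0)"
| step: "finite_rank F \<Longrightarrow> bounded_cfunctional f \<Longrightarrow> finite_rank (\<lambda>x. F x + f x *\<^sub>C u)"

lemma finite_rank_bounded_clinear: "finite_rank F \<Longrightarrow> bounded_clinear F"
proof (induction rule: finite_rank.induct)
  case zero
  show ?case by (rule bounded_clinear_intro[of _ 0]) auto
qed (intro bounded_clinear_add bounded_clinear_rank_one)

lemma finite_rank_add: 
  assumes "finite_rank F" "finite_rank G" shows "finite_rank (\<lambda>x. F x + G x)"
  using assms(2)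
proof (induction rule: finite_rank.induct)
  case (step G f u)
  from finite_rank.step[OF step(3,2), of u] show ?case by (simp add: add.assoc)
qed (use assms(1) in simp)

lemma finite_rank_left: 
  assumes "bounded_clinear A" "finite_rank F" shows "finite_rank (\<lambda>x. A (F x))"
  using assms(2)
proof (induction rule: finite_rank.induct)
  case (step F f u)
  from finite_rank.step[OF step(3,2), of "A u"] show ?case
    by (simp add: bounded_clinearD[OF assms(1)])
qed (simp add: bounded_clinearD[OF assms(1)] finite_rank.zero)

lemma finite_rank_right: 
  assumes "finite_rank F" "bounded_clinear A" shows "finite_rank (\<lambda>x. F (A x))"
  using assms(1)
proof (induction rule: finite_rank.induct)
  case (step F f u)
  from finite_rank.step[OF step(3) bounded_cfunctional_compose[OF step(2) assms(2)]] show ?case .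
qed (rule finite_rank.zero)

lemma finite_rank_uminus:
  assumes "finite_rank F" shows "finite_rank (\<lambda>x. - F x)"
  using finite_rank_left[OF bounded_clinear_scale[OF bounded_clinear_ident, of "-1"] assms]
  by simp

lemma finite_rank_diff: 
  assumes "finite_rank F" "finite_rank G" shows "finite_rank (\<lambda>x. F x - G x)"
  using finite_rank_add[OF assms(1) finite_rank_uminus[OF assms(2)]] by simp

lemma finite_rank_sum_form:
  assumes "finite_rank F"
  shows "\<exists>(m::nat) f u. (\<forall>i<m. bounded_cfunctional (f i)) \<and> (\<forall>x. F x = (\<Sum>i<m. f i x *\<^sub>C u i))"
  using assms
proof (induction rule: finite_rank.induct)
  case zero
  show ?case by (rule exI[of _ 0]) simp
next
  case (step F g v)
  then obtain m :: nat and f u where IH: "\<forall>i<m. bounded_cfunctional (f i)"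
    "\<forall>x. F x = (\<Sum>i<m. f i x *\<^sub>C u i)" by (elim exE conjE)
  have "F x + g x *\<^sub>C v = (\<Sum>i<Suc m. (f(m := g)) i x *\<^sub>C (u(m := v)) i)" for x
    using IH(2) by simp
  moreover have "\<forall>i<Suc m. bounded_cfunctional ((f(m := g)) i)"
    using IH(1) step(2) by (simp add: less_Suc_eq)
  ultimately show ?case by blast
qed

section \<open>Finite rank and finite-dimensional ranges\<close>

lemma finite_rank_range:
  assumes "finite_rank F"
  obtains B where "finite B" "range F \<subseteq> cspan B"
proof -
  obtain m :: nat and f u where F: "\<And>x. F x = (\<Sum>i<m. f i x *\<^sub>C u i)"
    using finite_rank_sum_form[OF assms] by blast
  show ?thesis
  proof (rule that[of "u ` {..<m}"])
    show "range F \<subseteq> cspan (u ` {..<m})"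
      unfolding F
      by (intro image_subsetI complex_vector.span_sum complex_vector.span_scale complex_vector.span_base) simp
  qed simp
qed

text \<open>The coefficient of \<open>b\<close> is controlled by the norm of the whole vector. Here
  \<open>\<delta>\<close> is the radius of a ball around \<open>b\<close> that misses the closed
  span; for nonzero \<open>c\<close> the vector \<open>c b + y\<close> is \<open>c\<close> times the
  difference of \<open>b\<close> and the element \<open>- y / c\<close> of the span.\<close>

lemma span_insert_distance:
  fixes B :: "'a::cbanach set"
  assumes "closed (cspan B)" "b \<notin> cspan B"
  obtains \<delta> where "\<delta> > 0" "\<And>c y. y \<in> cspan B \<Longrightarrow> \<delta> * cmod c \<le> norm (c *\<^sub>C b + y)"
proof -
  obtain \<delta> where \<delta>: "\<delta> > 0" "ball b \<delta> \<subseteq> - cspan B"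
    using assms open_contains_ball[of "- cspan B"] unfolding closed_def by blast
  show ?thesis
  proof (rule that[OF \<delta>(1)])
    fix c y assume y: "y \<in> cspan B"
    show "\<delta> * cmod c \<le> norm (c *\<^sub>C b + y)"
    proof (cases "c = 0")
      case False
      have "- ((1 / c) *\<^sub>C y) \<in> cspan B"
        using y by (intro complex_vector.span_neg complex_vector.span_scale)
      then have "- ((1 / c) *\<^sub>C y) \<notin> ball b \<delta>" using \<delta>(2) by blast
      then have "\<delta> \<le> norm (b + (1 / c) *\<^sub>C y)" by (simp add: dist_norm)
      then have "\<delta> * cmod c \<le> cmod c * norm (b + (1 / c) *\<^sub>C y)"
        by (subst mult.commute) (rule mult_left_mono[OF _ norm_ge_zero])
      also have "\<dots> = norm (c *\<^sub>C b + y)"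
        using False by (simp add: norm_scaleC[symmetric] scaleC_add_right scaleC_scaleC scaleC_one)
      finally show ?thesis .
    qed simp
  qed
qed

lemma closed_cspan_finite:
  fixes B :: "'a::cbanach set"
  assumes "finite B" shows "closed (cspan B)"
  using assms
proof (induction B rule: finite_induct)
  case (insert b B)
  show ?case
  proof (cases "b \<in> cspan B")
    case True
    then show ?thesis using insert.IH by (simp add: complex_vector.span_redundant)
  next
    case False
    obtain \<delta> where \<delta>: "\<delta> > 0" "\<And>c y. y \<in> cspan B \<Longrightarrow> \<delta> * cmod c \<le> norm (c *\<^sub>C b + y)"
      using span_insert_distance[OF insert.IH False] by blast
    show ?thesis
    proof (unfold closed_sequential_limits, intro allI impI)
      fix s l assume s: "(\<forall>n. s n \<in> cspan (insert b B)) \<and> s \<longlonglongrightarrow> l"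
      then have "\<forall>n. \<exists>c. s n - c *\<^sub>C b \<in> cspan B" by (simp add: complex_vector.span_insert)
      then obtain c where c: "\<And>n. s n - c n *\<^sub>C b \<in> cspan B" by metis
      have "Cauchy s" by (rule LIMSEQ_imp_Cauchy) (use s in blast)
      \<comment> \<open>The difference of two members has \<open>b\<close>-coefficient
        \<open>c m - c n\<close>, so the estimate with \<open>\<delta>\<close> carries the Cauchy
        property from \<open>s\<close> to \<open>c\<close>.\<close>
      have "Cauchy c"
      proof (rule CauchyI)
        fix e :: real assume "e > 0"
        then obtain M where M: "\<And>m n. m \<ge> M \<Longrightarrow> n \<ge> M \<Longrightarrow> norm (s m - s n) < e * \<delta>"
          using CauchyD[OF \<open>Cauchy s\<close>, of "e * \<delta>"] \<delta>(1) by auto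
        have "norm (c m - c n) < e" if "m \<ge> M" "n \<ge> M" for m n
        proof -
          have "(s m - c m *\<^sub>C b) - (s n - c n *\<^sub>C b) \<in> cspan B"
            by (intro complex_vector.span_diff c)
          from \<delta>(2)[OF this, of "c m - c n"] have "\<delta> * cmod (c m - c n) \<le> norm (s m - s n)"
            by (simp add: complex_vector.scale_left_diff_distrib)
          also have "\<dots> < \<delta> * e" using M[OF that] by (simp add: mult.commute)
          finally show ?thesis using \<delta>(1) by simp
        qed
        then show "\<exists>M. \<forall>m\<ge>M. \<forall>n\<ge>M. norm (c m - c n) < e" by blast
      qed
      then obtain c0 where c0: "c \<longlonglongrightarrow> c0" using Cauchy_convergent unfolding convergent_def by blast
      have "(\<lambda>n. c n *\<^sub>C b) \<longlonglongrightarrow> c0 *\<^sub>C b"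
      proof (rule Lim_null_comparison[THEN LIM_zero_cancel])
        show "\<forall>\<^sub>F n in sequentially. norm (c n *\<^sub>C b - c0 *\<^sub>C b) \<le> norm (c n - c0) * norm b"
          by (simp add: complex_vector.scale_left_diff_distrib[symmetric] norm_scaleC)
        show "(\<lambda>n. norm (c n - c0) * norm b) \<longlonglongrightarrow> 0"
          using c0 by (intro tendsto_mult_left_zero tendsto_norm_zero LIM_zero)
      qed
      with s have "(\<lambda>n. s n - c n *\<^sub>C b) \<longlonglongrightarrow> l - c0 *\<^sub>C b" by (intro tendsto_diff) auto
      then have "l - c0 *\<^sub>C b \<in> cspan B"
        by (rule closed_sequentially[OF insert.IH c])
      then show "l \<in> cspan (insert b B)" by (auto simp: complex_vector.span_insert)
    qed
  qed
qed simp

text \<open>One spanning vector is split off at a time. If \<open>b\<close> is new, its coefficient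
  in \<open>P x\<close> is unique, hence linear in \<open>x\<close>, and bounded by the distance
  estimate; subtracting that part leaves an operator into the span of the remaining vectors. The
  functionals are thus coordinates, and no extension theorem is involved.\<close>

lemma finite_rank_if_range_finite:
  fixes P :: "'a::cbanach \<Rightarrow> 'a"
  assumes "finite B" "bounded_clinear P" "range P \<subseteq> cspan B"
  shows "finite_rank P"
  using assms
proof (induction B arbitrary: P rule: finite_induct)
  case empty
  then have "P = (\<lambda>x. 0)" by auto
  then show ?case by (simp add: finite_rank.zero)
next
  case (insert b B)
  note P = bounded_clinearD[OF insert.prems(1)]
  show ?case
  proof (cases "b \<in> cspan B")
    case True
    then show ?thesis using insert by (simp add: complex_vector.span_redundant)
  next
    case False
    obtain \<delta> where \<delta>: "\<delta> > 0" "\<And>c y. y \<in> cspan B \<Longrightarrow> \<delta> * cmod c \<le> norm (c *\<^sub>C b + y)"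
      using span_insert_distance[OF closed_cspan_finite[OF insert.hyps(1)] False] by blast
    have uniq: "c = d" if "x - c *\<^sub>C b \<in> cspan B" "x - d *\<^sub>C b \<in> cspan B" for x c d
    proof -
      have "(x - c *\<^sub>C b) - (x - d *\<^sub>C b) \<in> cspan B" by (intro complex_vector.span_diff that)
      from \<delta>(2)[OF this, of "c - d"] have "\<delta> * cmod (c - d) \<le> 0"
        by (simp add: complex_vector.scale_left_diff_distrib)
      then show ?thesis using \<delta>(1) by (simp add: mult_le_0_iff)
    qed
    have "\<forall>x. \<exists>c. P x - c *\<^sub>C b \<in> cspan B"
      using insert.prems(2) by (auto simp: complex_vector.span_insert)
    then obtain f where f: "\<And>x. P x - f x *\<^sub>C b \<in> cspan B" by metis
    obtain K where K: "K > 0" "\<And>x. norm (P x) \<le> K * norm x"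
      using bounded_clinear_bound[OF insert.prems(1)] by blast
    have fb: "bounded_cfunctional f"
    proof (rule bounded_cfunctional_intro[of _ "K / \<delta>"])
      fix x y
      show "f (x + y) = f x + f y"
      proof (rule uniq[OF f])
        have "(P x - f x *\<^sub>C b) + (P y - f y *\<^sub>C b) \<in> cspan B" by (intro complex_vector.span_add f)
        then show "P (x + y) - (f x + f y) *\<^sub>C b \<in> cspan B"
          by (simp add: P scaleC_add_left algebra_simps)
      qed
      show "f (c *\<^sub>C x) = c * f x" for c
      proof (rule uniq[OF f])
        have "c *\<^sub>C (P x - f x *\<^sub>C b) \<in> cspan B" by (intro complex_vector.span_scale f)
        then show "P (c *\<^sub>C x) - (c * f x) *\<^sub>C b \<in> cspan B"
          by (simp add: P complex_vector.scale_right_diff_distrib scaleC_scaleC)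
      qed
      have "\<delta> * cmod (f x) \<le> K * norm x"
        using \<delta>(2)[OF f, of "f x" x] K(2)[of x] by simp
      then show "cmod (f x) \<le> K / \<delta> * norm x" using \<delta>(1) by (simp add: field_simps)
    qed
    have "finite_rank (\<lambda>x. P x - f x *\<^sub>C b)"
      by (rule insert.IH) (use f insert.prems(1) fb in \<open>auto intro: bounded_clinear_diff bounded_clinear_rank_one\<close>)
    from finite_rank.step[OF this fb, of b] show ?thesis by simp
  qed
qed

subsection \<open>Inverses of perturbed operators\<close>

lemma invertible_opI:
  assumes "bounded_clinear R" "\<And>x. R (A x) = x" "\<And>x. A (R x) = x"
  shows "invertible_op A"
  unfolding invertible_op_def using assms by (intro exI[of _ R]) (auto simp: fun_eq_iff)

lemma invertible_opE:
  assumes "invertible_op A"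
  obtains R where "bounded_clinear R" "\<And>x. R (A x) = x" "\<And>x. A (R x) = x"
proof -
  obtain R where R: "bounded_clinear R" "R \<circ> A = id" "A \<circ> R = id"
    using assms unfolding invertible_op_def by blast
  show ?thesis by (rule that[OF R(1)]) (use R(2,3) in \<open>auto simp: fun_eq_iff\<close>)
qed

lemma invertible_op_compose:
  assumes "invertible_op A" "invertible_op B" shows "invertible_op (\<lambda>x. A (B x))"
proof -
  from assms(1) obtain R where R: "bounded_clinear R" "\<And>x. R (A x) = x" "\<And>x. A (R x) = x"
    by (rule invertible_opE) blast
  from assms(2) obtain Q where Q: "bounded_clinear Q" "\<And>x. Q (B x) = x" "\<And>x. B (Q x) = x"
    by (rule invertible_opE) blast
  show ?thesis
    by (rule invertible_opI[OF bounded_clinear_compose[OF Q(1) R(1)]]) (simp_all add: R Q)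
qed

text \<open>The equation \<open>x - A x = y\<close> is the fixed point equation of the contraction
  sending \<open>x\<close> to \<open>y + A x\<close>. The lower estimate \<open>low\<close> gives
  uniqueness, which makes the solution operator linear, and also its norm bound.\<close>

lemma neumann_inverse:
  fixes A :: "'a::cbanach \<Rightarrow> 'a"
  assumes A: "bounded_clinear A" "\<And>x. norm (A x) \<le> q * norm x" and q: "0 \<le> q" "q < 1"
  shows "\<exists>R. bounded_clinear R \<and> (\<forall>x. R x - A (R x) = x) \<and> (\<forall>x. R (x - A x) = x)
    \<and> (\<forall>x. norm (R x) \<le> 1 / (1 - q) * norm x)"
proof -
  note lin = bounded_clinearD[OF A(1)]
  have low: "(1 - q) * norm x \<le> norm (x - A x)" for x
    using norm_triangle_ineq2[of x "A x"] A(2)[of x] by (simp add: algebra_simps)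
  have inj: "x = y" if "x - A x = y - A y" for x y
  proof -
    have "(x - y) - A (x - y) = 0" using that by (simp add: lin algebra_simps)
    then have "(1 - q) * norm (x - y) \<le> 0" using low[of "x - y"] by simp
    then show ?thesis using q by (simp add: mult_le_0_iff)
  qed
  have "\<exists>x. x - A x = y" for y
  proof -
    have "\<exists>!x. y + A x = x"
    proof (rule banach_fix_type[OF q], intro allI)
      show "dist (y + A u) (y + A v) \<le> q * dist u v" for u v
        using A(2)[of "u - v"] by (simp add: dist_norm lin)
    qed
    then show ?thesis by (metis add_diff_cancel_right')
  qed
  then obtain R where R: "\<And>y. R y - A (R y) = y" by metis
  have "bounded_clinear R"
  proof (rule bounded_clinear_intro[of _ "1 / (1 - q)"])
    show "R (x + y) = R x + R y" for x y
    proof (rule inj)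
      have "(R x + R y) - A (R x + R y) = (R x - A (R x)) + (R y - A (R y))" by (simp add: lin)
      then show "R (x + y) - A (R (x + y)) = (R x + R y) - A (R x + R y)" by (simp only: R)
    qed
    show "R (c *\<^sub>C x) = c *\<^sub>C R x" for c x
      by (rule inj) (simp add: R lin complex_vector.scale_right_diff_distrib[symmetric])
    show "norm (R x) \<le> 1 / (1 - q) * norm x" for x
      using low[of "R x"] q by (simp add: R field_simps)
  qed
  moreover have "R (x - A x) = x" for x by (rule inj) (simp add: R)
  moreover have "norm (R x) \<le> 1 / (1 - q) * norm x" for x
    using low[of "R x"] q by (simp add: R field_simps)
  ultimately show ?thesis using R by blast
qed

lemma bounded_clinear_funpow: "bounded_clinear A \<Longrightarrow> bounded_clinear (A ^^ n)"
proof (induction n)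
  case (Suc n)
  then show ?case using bounded_clinear_compose[of A "A ^^ n"] by (simp add: comp_def)
qed (simp add: id_def bounded_clinear_ident)

text \<open>As \<open>Q t\<close> is a right inverse of \<open>I - t K\<close>, the function is a
  scalar Neumann series with coefficients \<open>f ((K ^^ n) v)\<close>. Scalar holomorphy is
  enough: the resolvent enters later only through matrix entries of this kind.\<close>

lemma resolvent_functional_holomorphic:
  assumes K: "bounded_clinear K" "\<And>x. norm (K x) \<le> k * norm x" and k: "0 \<le> k" "\<rho> * k \<le> 1"
    and Q: "\<And>t x. cmod t < \<rho> \<Longrightarrow> Q t x - t *\<^sub>C K (Q t x) = x"
    and f: "bounded_cfunctional f"
  shows "(\<lambda>t. f (Q t v)) holomorphic_on ball 0 \<rho>"
proof (rule power_series_holomorphic)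
  fix w :: complex assume "w \<in> ball 0 \<rho>"
  then have w: "cmod w < \<rho>" by simp
  define x where "x = Q w v"
  have x: "x = v + w *\<^sub>C K x" using Q[OF w, of v] by (simp add: x_def algebra_simps)
  obtain C where C: "C > 0" "\<And>x. cmod (f x) \<le> C * norm x"
    using bounded_cfunctional_bound[OF f] by blast
  have powK: "norm ((K ^^ n) y) \<le> k ^ n * norm y" for n y
  proof (induction n)
    case (Suc n)
    have "norm ((K ^^ Suc n) y) \<le> k * norm ((K ^^ n) y)" using K(2) by simp
    also have "\<dots> \<le> k * (k ^ n * norm y)" using Suc k(1) by (rule mult_left_mono)
    finally show ?case by (simp add: mult.assoc)
  qed simp
  \<comment> \<open>Iterating \<open>x = v + w K x\<close> puts the partial sums into closed form;
    the remainder is of order \<open>(|w| k) ^ n\<close>.\<close>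
  have part: "(\<Sum>i<n. f ((K ^^ i) v) * (w - 0) ^ i) = f x - w ^ n * f ((K ^^ n) x)" for n
  proof (induction n)
    case (Suc n)
    have "(K ^^ n) x = (K ^^ n) v + w *\<^sub>C (K ^^ n) (K x)"
      by (subst x) (simp add: bounded_clinearD[OF bounded_clinear_funpow[OF K(1)]])
    then have "f ((K ^^ n) x) = f ((K ^^ n) v) + w * f ((K ^^ Suc n) x)"
      using funpow_swap1[of K n x] by (simp add: bounded_cfunctionalD[OF f])
    then show ?case using Suc by (simp add: algebra_simps)
  qed simp
  have "(\<lambda>n. w ^ n * f ((K ^^ n) x)) \<longlonglongrightarrow> 0"
  proof (rule Lim_null_comparison)
    show "\<forall>\<^sub>F n in sequentially. norm (w ^ n * f ((K ^^ n) x)) \<le> (cmod w * k) ^ n * (C * norm x)"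
    proof (intro always_eventually allI)
      fix n
      have "cmod (f ((K ^^ n) x)) \<le> C * (k ^ n * norm x)"
        using C powK[of n x] by (meson mult_left_mono order_trans less_imp_le)
      then have "cmod w ^ n * cmod (f ((K ^^ n) x)) \<le> cmod w ^ n * (C * (k ^ n * norm x))"
        by (rule mult_left_mono) simp
      then show "norm (w ^ n * f ((K ^^ n) x)) \<le> (cmod w * k) ^ n * (C * norm x)"
        by (simp add: norm_mult norm_power power_mult_distrib mult_ac)
    qed
    have "cmod w * k < 1"
    proof (cases "k = 0")
      case False
      then have "cmod w * k < \<rho> * k" using w k(1) by simp
      then show ?thesis using k(2) by simp
    qed simp
    then have "(\<lambda>n. (cmod w * k) ^ n) \<longlonglongrightarrow> 0" using k(1) by (intro LIMSEQ_power_zero) simp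
    then show "(\<lambda>n. (cmod w * k) ^ n * (C * norm x)) \<longlonglongrightarrow> 0" by (rule tendsto_mult_left_zero)
  qed
  then have "(\<lambda>n. f x - w ^ n * f ((K ^^ n) x)) \<longlonglongrightarrow> f x - 0" by (intro tendsto_intros)
  then show "(\<lambda>n. f ((K ^^ n) v) * (w - 0) ^ n) sums f (Q w v)"
    unfolding sums_def part by (simp add: x_def)
qed

text \<open>The question is one about the square matrix with entries \<open>f i (u j)\<close>
  subtracted from the identity. A kernel vector \<open>c\<close> of it would give a nonzero fixed
  vector of \<open>F\<close>, the sum of the \<open>c j u j\<close>. Otherwise Cramer's rule
  provides the inverse.\<close>

lemma finite_rank_injective_imp_invertible:
  fixes F :: "'a::cbanach \<Rightarrow> 'a"
  assumes F: "finite_rank F" and inj: "\<And>x. x - F x = 0 \<Longrightarrow> x = 0"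
  shows "invertible_op (\<lambda>x. x - F x)"
proof -
  obtain m :: nat and f u where f: "\<And>i. i < m \<Longrightarrow> bounded_cfunctional (f i)"
    and Fx: "\<And>x. F x = (\<Sum>i<m. f i x *\<^sub>C u i)"
    using finite_rank_sum_form[OF F] by blast
  \<comment> \<open>Constant in \<open>z\<close>: the holomorphic statement is reused for its
    algebra, evaluated at \<open>0\<close>.\<close>
  define a :: "nat \<Rightarrow> nat \<Rightarrow> complex \<Rightarrow> complex"
    where "a = (\<lambda>i j z. (if i = j then 1 else 0) - f i (u j))"
  have hol: "\<forall>i<m. \<forall>j<m. a i j holomorphic_on UNIV" unfolding a_def by simp
  obtain h b where
    adj: "\<forall>z c. \<forall>i<m. (\<Sum>j<m. b i j z * (\<Sum>k<m. a j k z * c k)) = h z * c i"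
      "\<forall>z c. \<forall>i<m. (\<Sum>j<m. a i j z * (\<Sum>k<m. b j k z * c k)) = h z * c i"
      "\<forall>z. h z = 0 \<longrightarrow> (\<exists>c. (\<exists>i<m. c i \<noteq> 0) \<and> (\<forall>i<m. (\<Sum>j<m. a i j z * c j) = 0))"
    using holomorphic_adjugate[of m a UNIV, OF hol] by (elim exE conjE) (rule that)
  note ba = adj(1)[rule_format] and ab = adj(2)[rule_format] and h0 = adj(3)[rule_format]
  have row: "(\<Sum>j<m. a i j 0 * c j) = c i - f i (\<Sum>j<m. c j *\<^sub>C u j)" if "i < m" for i c
  proof -
    have "(\<Sum>j<m. a i j 0 * c j) = (\<Sum>j<m. (if i = j then c j else 0) - c j * f i (u j))"
      by (rule sum.cong) (auto simp: a_def algebra_simps)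
    also have "\<dots> = c i - (\<Sum>j<m. c j * f i (u j))" using that by (simp add: sum_subtractf)
    finally show ?thesis using that by (simp add: bounded_cfunctionalD[OF f])
  qed
  have hn: "h 0 \<noteq> 0"
  proof
    assume "h 0 = 0"
    then obtain c i where c: "i < m" "c i \<noteq> 0" "\<forall>i<m. (\<Sum>j<m. a i j 0 * c j) = 0"
      using h0 by blast
    define x where "x = (\<Sum>j<m. c j *\<^sub>C u j)"
    have fx: "f i x = c i" if "i < m" for i using row[OF that, of c] c(3) that by (simp add: x_def)
    have "F x = x" unfolding Fx by (subst x_def) (auto intro!: sum.cong simp: fx)
    then have "x = 0" using inj by simp
    then show False using fx[OF c(1)] c(1,2) by (simp add: bounded_cfunctionalD[OF f])
  qed
  \<comment> \<open>Applying each \<open>f i\<close> to \<open>x - F x = y\<close> gives a linear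
    system for the numbers \<open>f j x\<close>. Its solution is \<open>g j y\<close>, and
    \<open>x = y + F x\<close> becomes the formula for \<open>R\<close>.\<close>
  define g where "g = (\<lambda>j y. \<Sum>k<m. (b j k 0 / h 0) * f k y)"
  define R where "R = (\<lambda>y. y + (\<Sum>j<m. g j y *\<^sub>C u j))"
  have g: "bounded_cfunctional (g j)" for j
    unfolding g_def by (intro bounded_cfunctional_sum bounded_cfunctional_scale f) simp
  have R: "bounded_clinear R"
  proof -
    have "bounded_clinear (\<lambda>y. \<Sum>j<n. g j y *\<^sub>C u j)" for n
    proof (induction n)
      case 0
      show ?case using finite_rank_bounded_clinear[OF finite_rank.zero] by simp
    next
      case (Suc n)
      then show ?case by (simp add: bounded_clinear_add bounded_clinear_rank_one[OF g])
    qed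
    then show ?thesis unfolding R_def by (intro bounded_clinear_add bounded_clinear_ident)
  qed
  show ?thesis
  proof (rule invertible_opI[OF R])
    fix x
    have "g j (x - F x) = f j x" if "j < m" for j
    proof -
      have "f k (x - F x) = (\<Sum>i<m. a k i 0 * f i x)" if "k < m" for k
        using that by (subst row[OF that]) (simp add: Fx bounded_cfunctionalD(3)[OF f])
      then have "g j (x - F x) = (\<Sum>k<m. b j k 0 * (\<Sum>i<m. a k i 0 * f i x)) / h 0"
        by (simp add: g_def sum_divide_distrib[symmetric])
      then show ?thesis using ba[OF that, of 0 "\<lambda>i. f i x"] hn by simp
    qed
    then show "R (x - F x) = x" by (simp add: R_def Fx)
    have "f i (R x) = g i x" if "i < m" for i
    proof -
      have "(\<Sum>j<m. a i j 0 * g j x) = (\<Sum>j<m. a i j 0 * (\<Sum>k<m. b j k 0 * f k x)) / h 0"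
        by (simp add: g_def sum_divide_distrib[symmetric])
      then have "(\<Sum>j<m. a i j 0 * g j x) = f i x" using ab[OF that, of 0 "\<lambda>k. f k x"] hn by simp
      then show ?thesis using row[OF that, of "\<lambda>j. g j x"] that
        by (simp add: R_def bounded_cfunctionalD(2)[OF f] algebra_simps)
    qed
    then show "R x - F (R x) = x" by (simp add: Fx) (simp add: R_def)
  qed
qed

text \<open>With \<open>Q t\<close> inverse to \<open>I - t K\<close>, one has
  \<open>I - t K - F = (I - t K) (I - Q t F)\<close>, so degeneracy is decided by the determinant
  \<open>h\<close> of a holomorphic matrix. Either \<open>h\<close> vanishes on the whole disc and
  each operator of the family has a kernel, or its zeros have finite order, which becomes the
  exponent of a lower bound.\<close>

lemma analytic_fredholm_local:
  fixes K F :: "'a::cbanach \<Rightarrow> 'a"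
  assumes K: "bounded_clinear K" and F: "finite_rank F"
  shows "\<exists>\<rho>>0. (\<forall>t. cmod t < \<rho> \<longrightarrow> (\<exists>x. x \<noteq> 0 \<and> x - t *\<^sub>C K x - F x = 0))
    \<or> (\<forall>s. cmod s < \<rho> \<longrightarrow> (\<exists>(p::nat) k e. k > 0 \<and> e > 0 \<and>
        (\<forall>t x. cmod (t - s) < e \<longrightarrow> k * cmod (t - s) ^ p * norm x \<le> norm (x - t *\<^sub>C K x - F x))))"
proof -
  note Kl = bounded_clinearD[OF K]
  obtain m :: nat and f u where f: "\<And>i. i < m \<Longrightarrow> bounded_cfunctional (f i)"
    and Fx: "\<And>x. F x = (\<Sum>i<m. f i x *\<^sub>C u i)"
    using finite_rank_sum_form[OF F] by blast
  obtain k where k: "k > 0" "\<And>x. norm (K x) \<le> k * norm x" using bounded_clinear_bound[OF K] by blast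
  \<comment> \<open>Half of \<open>1 / k\<close>: then \<open>t K\<close> has norm at most
    \<open>1 / 2\<close> and \<open>Q t\<close> has norm at most \<open>2\<close>, uniformly on the
    disc.\<close>
  define \<rho> where "\<rho> = 1 / (2 * k)"
  have \<rho>: "\<rho> > 0" "\<rho> * k \<le> 1" using k(1) by (simp_all add: \<rho>_def)
  have "\<exists>Q. cmod t < \<rho> \<longrightarrow> bounded_clinear Q \<and> (\<forall>x. Q x - t *\<^sub>C K (Q x) = x)
      \<and> (\<forall>x. Q (x - t *\<^sub>C K x) = x) \<and> (\<forall>x. norm (Q x) \<le> 1 / (1 - 1/2) * norm x)" for t
  proof (cases "cmod t < \<rho>")
    case True
    have "norm (t *\<^sub>C K x) \<le> 1 / 2 * norm x" for x
    proof -
      have "cmod t * norm (K x) \<le> \<rho> * (k * norm x)"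
        using True k \<rho>(1) by (intro mult_mono) auto
      then show ?thesis using k(1) by (simp add: norm_scaleC \<rho>_def)
    qed
    from neumann_inverse[OF bounded_clinear_scale[OF K] this] show ?thesis by simp
  qed simp
  then obtain Q where Q0: "\<And>t. cmod t < \<rho> \<longrightarrow> bounded_clinear (Q t) \<and> (\<forall>x. Q t x - t *\<^sub>C K (Q t x) = x)
      \<and> (\<forall>x. Q t (x - t *\<^sub>C K x) = x) \<and> (\<forall>x. norm (Q t x) \<le> 1 / (1 - 1/2) * norm x)"
    by metis
  have Q: "bounded_clinear (Q t)" "Q t x - t *\<^sub>C K (Q t x) = x" "Q t (x - t *\<^sub>C K x) = x"
    "norm (Q t x) \<le> 2 * norm x" if "cmod t < \<rho>" for t x
    using Q0[of t] that by auto
  define a where "a = (\<lambda>i j t. (if i = j then 1 else 0) - f i (Q t (u j)))"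
  have hol: "\<forall>i<m. \<forall>j<m. a i j holomorphic_on ball 0 \<rho>"
    unfolding a_def
    by (intro allI impI holomorphic_on_diff holomorphic_on_const
        resolvent_functional_holomorphic[OF K k(2) _ \<rho>(2) Q(2) f]) (use k in auto)
  obtain h b where hb: "h holomorphic_on ball 0 \<rho>" "\<forall>i<m. \<forall>j<m. b i j holomorphic_on ball 0 \<rho>" and
    adj: "\<forall>z c. \<forall>i<m. (\<Sum>j<m. b i j z * (\<Sum>k<m. a j k z * c k)) = h z * c i"
      "\<forall>z. h z = 0 \<longrightarrow> (\<exists>c. (\<exists>i<m. c i \<noteq> 0) \<and> (\<forall>i<m. (\<Sum>j<m. a i j z * c j) = 0))"
    using holomorphic_adjugate[of m a "ball 0 \<rho>", OF hol] by (elim exE conjE) (rule that)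
  note ba = adj(1)[rule_format] and h0 = adj(2)[rule_format]
  have row: "(\<Sum>j<m. a i j t * c j) = c i - f i (\<Sum>j<m. c j *\<^sub>C Q t (u j))" if "i < m" for i t c
  proof -
    have "(\<Sum>j<m. a i j t * c j) = (\<Sum>j<m. (if i = j then c j else 0) - c j * f i (Q t (u j)))"
      by (rule sum.cong) (auto simp: a_def algebra_simps)
    also have "\<dots> = c i - (\<Sum>j<m. c j * f i (Q t (u j)))" using that by (simp add: sum_subtractf)
    finally show ?thesis using that by (simp add: bounded_cfunctionalD[OF f])
  qed
  show ?thesis
  proof (intro exI[of _ \<rho>] conjI \<rho>)
    show "(\<forall>t. cmod t < \<rho> \<longrightarrow> (\<exists>x. x \<noteq> 0 \<and> x - t *\<^sub>C K x - F x = 0))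
      \<or> (\<forall>s. cmod s < \<rho> \<longrightarrow> (\<exists>(p::nat) k e. k > 0 \<and> e > 0 \<and>
        (\<forall>t x. cmod (t - s) < e \<longrightarrow> k * cmod (t - s) ^ p * norm x \<le> norm (x - t *\<^sub>C K x - F x))))"
    proof (cases "\<forall>t\<in>ball 0 \<rho>. h t = 0")
      case True
      have "\<exists>x. x \<noteq> 0 \<and> x - t *\<^sub>C K x - F x = 0" if t: "cmod t < \<rho>" for t
      proof -
        have "h t = 0" using True t by simp
        then obtain c i where c: "i < m" "c i \<noteq> 0" "\<forall>i<m. (\<Sum>j<m. a i j t * c j) = 0"
          using h0 by blast
        \<comment> \<open>\<open>I - t K\<close> maps this vector to the sum of the
          \<open>c j u j\<close>; since \<open>f j x = c j\<close>, that sum is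
          \<open>F x\<close>.\<close>
        define x where "x = (\<Sum>j<m. c j *\<^sub>C Q t (u j))"
        have fx: "f i x = c i" if "i < m" for i using row[OF that, of t c] c(3) that by (simp add: x_def)
        have "x \<noteq> 0" using fx[OF c(1)] c(1,2) by (auto simp: bounded_cfunctionalD[OF f])
        moreover have "x - t *\<^sub>C K x = (\<Sum>j<m. c j *\<^sub>C (Q t (u j) - t *\<^sub>C K (Q t (u j))))"
          by (simp add: x_def Kl complex_vector.scale_right_diff_distrib sum_subtractf
              complex_vector.scale_sum_right mult.commute)
        then have "x - t *\<^sub>C K x = F x" using fx by (simp add: Q(2)[OF t] Fx)
        ultimately show ?thesis by (intro exI[of _ x]) simp
      qed
      then show ?thesis by blast
    next
      case False
      have "\<exists>(p::nat) k e. k > 0 \<and> e > 0 \<and>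
        (\<forall>t x. cmod (t - s) < e \<longrightarrow> k * cmod (t - s) ^ p * norm x \<le> norm (x - t *\<^sub>C K x - F x))"
        if s: "cmod s < \<rho>" for s
      proof -
        obtain p :: nat and k1 e1 :: real where k1: "k1 > 0" "e1 > 0"
          "\<forall>z. dist z s < e1 \<longrightarrow> k1 * cmod (z - s) ^ p \<le> cmod (h z)"
        proof -
          have "\<exists>z\<in>ball 0 \<rho>. h z \<noteq> 0" "s \<in> ball 0 \<rho>" using False s by auto
          from holomorphic_zero_order_bound[OF hb(1) open_ball connected_ball this(2,1)]
          show ?thesis by (elim exE conjE) (rule that)
        qed
        define e2 where "e2 = (\<rho> - cmod s) / 2"
        have e2: "e2 > 0" "cball s e2 \<subseteq> ball 0 \<rho>"
        proof -
          show "e2 > 0" using s by (simp add: e2_def)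
          show "cball s e2 \<subseteq> ball 0 \<rho>"
          proof
            fix z assume "z \<in> cball s e2"
            then have "cmod (z - s) < \<rho> - cmod s" using s by (auto simp: e2_def dist_norm norm_minus_commute)
            then show "z \<in> ball 0 \<rho>" using norm_triangle_ineq2[of z s] by simp
          qed
        qed
        \<comment> \<open>One continuous majorant for \<open>h\<close> and all adjugate entries, so
          that a single maximum over the compact disc bounds them together.\<close>
        define G where "G = (\<lambda>z. cmod (h z) + (\<Sum>i<m. \<Sum>j<m. cmod (b i j z)))"
        have "continuous_on (cball s e2) G"
          unfolding G_def using hb e2(2)
          by (intro continuous_intros)
            (auto intro!: holomorphic_on_imp_continuous_on intro: holomorphic_on_subset)
        moreover have "cball s e2 \<noteq> {}" using e2(1) by simp
        ultimately obtain z0 where z0: "\<And>z. z \<in> cball s e2 \<Longrightarrow> G z \<le> G z0"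
          using continuous_attains_sup[OF compact_cball] by blast
        define B where "B = G z0"
        have hB: "cmod (h z) \<le> B" if "z \<in> cball s e2" for z
        proof -
          have "cmod (h z) \<le> G z" by (simp add: G_def sum_nonneg)
          then show ?thesis using z0[OF that] by (simp add: B_def)
        qed
        have bB: "cmod (b i j z) \<le> B" if "z \<in> cball s e2" "i < m" "j < m" for z i j
        proof -
          have "cmod (b i j z) \<le> (\<Sum>j<m. cmod (b i j z))"
            using that by (intro member_le_sum[of j "{..<m}" "\<lambda>j. cmod (b i j z)"]) auto
          also have "\<dots> \<le> (\<Sum>i<m. \<Sum>j<m. cmod (b i j z))"
            using that by (intro member_le_sum[of i "{..<m}" "\<lambda>i. \<Sum>j<m. cmod (b i j z)"]) (auto intro: sum_nonneg)
          also have "\<dots> \<le> G z" by (simp add: G_def)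
          finally show ?thesis using z0[OF that(1)] by (simp add: B_def)
        qed
        have B: "B \<ge> 0" using hB[of s] e2(1) by (auto intro: order_trans[OF norm_ge_zero])
        have "\<exists>C. i < m \<longrightarrow> (\<forall>x. cmod (f i x) \<le> C * norm x) \<and> C > 0" for i
          using bounded_cfunctional_bound[OF f] by (metis (no_types))
        then obtain C where C: "\<And>i. i < m \<longrightarrow> (\<forall>x. cmod (f i x) \<le> C i * norm x) \<and> C i > 0" by metis
        define M where "M = (\<Sum>j<m. B * C j)"
        have M: "M \<ge> 0" unfolding M_def using B C
          by (intro sum_nonneg mult_nonneg_nonneg) (auto intro: less_imp_le)
        define W where "W = (\<Sum>j<m. M * (2 * norm (u j)))"
        have W: "W \<ge> 0" unfolding W_def using M by (intro sum_nonneg) auto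
        \<comment> \<open>\<open>B + W\<close> bounds \<open>|h t| * norm x\<close> against
          \<open>norm z\<close>, the factor \<open>2\<close> passes from \<open>z = Q t y\<close> to
          \<open>y\<close>, and the \<open>1\<close> makes \<open>E\<close> a positive
          divisor.\<close>
        define E where "E = (B + W) * 2 + 1"
        have E: "E > 0" using B W by (simp add: E_def)
        have main: "k1 * cmod (t - s) ^ p * norm x \<le> E * norm (x - t *\<^sub>C K x - F x)"
          if t: "cmod (t - s) < min e1 e2" for t x
        proof -
          have ts: "t \<in> cball s e2" using t by (auto simp: dist_norm norm_minus_commute)
          then have tr: "cmod t < \<rho>" using e2(2) by auto
          note Ql = bounded_clinearD[OF Q(1)[OF tr]]
          define y where "y = x - t *\<^sub>C K x - F x"
          \<comment> \<open>After \<open>Q t\<close> is applied, \<open>f j z\<close> is row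
            \<open>j\<close> of the matrix applied to the numbers \<open>f k x\<close>. Multiplying
            by \<open>h t\<close> instead of inverting the matrix keeps the constants uniform as
            \<open>t\<close> approaches a zero of \<open>h\<close>.\<close>
          define z where "z = Q t y"
          have "z = Q t (x - t *\<^sub>C K x) - Q t (F x)" by (simp add: z_def y_def Ql)
          then have z: "z = x - (\<Sum>j<m. f j x *\<^sub>C Q t (u j))" by (simp only: Q(3)[OF tr] Fx Ql(4,7))
          have nz: "norm z \<le> 2 * norm y" by (simp add: z_def Q(4)[OF tr])
          have hf: "cmod (h t) * cmod (f i x) \<le> M * norm z" if i: "i < m" for i
          proof -
            have "f j z = (\<Sum>k<m. a j k t * f k x)" if "j < m" for j
              using that by (subst row[OF that]) (simp add: z bounded_cfunctionalD(3)[OF f])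
            then have "h t * f i x = (\<Sum>j<m. b i j t * f j z)" using ba[OF i, of t "\<lambda>k. f k x"] by simp
            then have "cmod (h t) * cmod (f i x) = cmod (\<Sum>j<m. b i j t * f j z)"
              by (metis norm_mult)
            also have "\<dots> \<le> (\<Sum>j<m. B * (C j * norm z))"
            proof (rule sum_norm_le)
              fix j assume "j \<in> {..<m}"
              then have "cmod (b i j t) * cmod (f j z) \<le> B * (C j * norm z)"
                using bB[OF ts i] C B by (intro mult_mono) auto
              then show "cmod (b i j t * f j z) \<le> B * (C j * norm z)" by (simp add: norm_mult)
            qed
            also have "\<dots> = M * norm z" by (simp add: M_def sum_distrib_right mult.assoc)
            finally show ?thesis .
          qed
          have "h t *\<^sub>C x = h t *\<^sub>C z + (\<Sum>j<m. (h t * f j x) *\<^sub>C Q t (u j))"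
            by (simp add: z complex_vector.scale_right_diff_distrib complex_vector.scale_sum_right scaleC_scaleC)
          then have "cmod (h t) * norm x = norm (h t *\<^sub>C z + (\<Sum>j<m. (h t * f j x) *\<^sub>C Q t (u j)))"
            by (metis norm_scaleC)
          also have "\<dots> \<le> norm (h t *\<^sub>C z) + norm (\<Sum>j<m. (h t * f j x) *\<^sub>C Q t (u j))"
            by (rule norm_triangle_ineq)
          also have "\<dots> \<le> B * norm z + (\<Sum>j<m. M * norm z * (2 * norm (u j)))"
          proof (intro add_mono sum_norm_le)
            show "norm (h t *\<^sub>C z) \<le> B * norm z" using hB[OF ts] by (simp add: norm_scaleC mult_right_mono)
            fix j assume "j \<in> {..<m}"
            then have "cmod (h t) * cmod (f j x) * norm (Q t (u j)) \<le> M * norm z * (2 * norm (u j))"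
              using M by (intro mult_mono[OF hf Q(4)[OF tr]]) auto
            then show "norm ((h t * f j x) *\<^sub>C Q t (u j)) \<le> M * norm z * (2 * norm (u j))"
              by (simp add: norm_scaleC norm_mult)
          qed
          also have "(\<Sum>j<m. M * norm z * (2 * norm (u j))) = W * norm z"
            unfolding W_def sum_distrib_right by (rule sum.cong) (simp_all add: mult_ac)
          also have "B * norm z + W * norm z = (B + W) * norm z" by (simp add: distrib_right)
          also have "\<dots> \<le> (B + W) * (2 * norm y)" using nz B W by (intro mult_left_mono) auto
          also have "\<dots> \<le> E * norm y" by (simp add: E_def algebra_simps)
          finally have "cmod (h t) * norm x \<le> E * norm y" .
          moreover have "k1 * cmod (t - s) ^ p * norm x \<le> cmod (h t) * norm x"
            using k1(3) t by (intro mult_right_mono) (auto simp: dist_norm)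
          ultimately show ?thesis by (simp add: y_def)
        qed
        show ?thesis
        proof (rule exI[of _ p], rule exI[of _ "k1 / E"], rule exI[of _ "min e1 e2"], intro conjI allI impI)
          fix t x assume "cmod (t - s) < min e1 e2"
          from main[OF this, of x] show "k1 / E * cmod (t - s) ^ p * norm x \<le> norm (x - t *\<^sub>C K x - F x)"
            using E by (simp add: field_simps)
        qed (use k1 E e2 in auto)
      qed
      then show ?thesis by blast
    qed
  qed
qed

subsection \<open>Index zero along a connected set\<close>

definition left_inverse :: "('a::complex_normed_vector \<Rightarrow> 'a) \<Rightarrow> ('a \<Rightarrow> 'a) \<Rightarrow> bool" where
  "left_inverse L A \<longleftrightarrow> bounded_clinear L \<and> (\<forall>x. L (A x) = x)"

lemma left_invertible_iff: "left_invertible A \<longleftrightarrow> (\<exists>L. left_inverse L A)"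
  unfolding left_invertible_def left_inverse_def by (auto simp: fun_eq_iff)

text \<open>From \<open>M A = I\<close> it follows that
  \<open>(I - A M) (I - A L) = I - A M\<close>.\<close>

lemma finite_rank_defect_left_inverse:
  assumes A: "bounded_clinear A" and L: "left_inverse L A" and M: "left_inverse M A"
    and fr: "finite_rank (\<lambda>x. x - A (L x))"
  shows "finite_rank (\<lambda>x. x - A (M x))"
proof -
  have Mb: "bounded_clinear M" "\<And>x. M (A x) = x" using M by (auto simp: left_inverse_def)
  have "bounded_clinear (\<lambda>x. x - A (M x))"
    by (intro bounded_clinear_diff bounded_clinear_ident bounded_clinear_compose[OF A Mb(1)])
  from finite_rank_left[OF this fr] show ?thesis
    by (simp add: bounded_clinearD[OF A] bounded_clinearD[OF Mb(1)] Mb(2))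
qed

text \<open>One step in the constancy of the index, from \<open>c + t1\<close> to
  \<open>c + t2\<close>, through a single left inverse \<open>L\<close> at \<open>c\<close>. As
  \<open>L (T - (c + t)) = I - t L\<close>, the shifted operators \<open>T1\<close> and
  \<open>T2\<close> have left inverses \<open>R1 L\<close> and \<open>R2 L\<close>. The operator
  \<open>J = R1 L T2\<close> is invertible, and \<open>T1 J\<close> differs from \<open>T2\<close>
  by finite rank; applying \<open>S\<close> compares the two pencils, because
  \<open>S T1 = I - (c + t1) S\<close>.\<close>

lemma index_zero_transfer:
  fixes T :: "'a::cbanach \<Rightarrow> 'a"
  assumes T: "bounded_clinear T" and S: "left_inverse S T"
    and L: "bounded_clinear L" "\<And>x. L (T x - c *\<^sub>C x) = x"
    and R: "bounded_clinear R1" "\<And>x. R1 (x - t1 *\<^sub>C L x) = x" "\<And>x. R1 x - t1 *\<^sub>C L (R1 x) = x"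
      "bounded_clinear R2" "\<And>x. R2 (x - t2 *\<^sub>C L x) = x" "\<And>x. R2 x - t2 *\<^sub>C L (R2 x) = x"
    and L': "left_inverse L' (\<lambda>x. T x - (c + t1) *\<^sub>C x)"
      "finite_rank (\<lambda>x. x - (T (L' x) - (c + t1) *\<^sub>C L' x))"
    and F: "finite_rank F" "invertible_op (\<lambda>x. x - (c + t1) *\<^sub>C S x + F x)"
  shows "\<exists>L'. left_inverse L' (\<lambda>x. T x - (c + t2) *\<^sub>C x)
      \<and> finite_rank (\<lambda>x. x - (T (L' x) - (c + t2) *\<^sub>C L' x))"
    and "\<exists>F. finite_rank F \<and> invertible_op (\<lambda>x. x - (c + t2) *\<^sub>C S x + F x)"
proof -
  note simps = bounded_clinearD[OF T] bounded_clinearD[OF L(1)] bounded_clinearD[OF R(1)]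
    bounded_clinearD[OF R(4)]
  define T1 where "T1 = (\<lambda>x. T x - (c + t1) *\<^sub>C x)"
  define T2 where "T2 = (\<lambda>x. T x - (c + t2) *\<^sub>C x)"
  have T1: "bounded_clinear T1" and T2: "bounded_clinear T2"
    unfolding T1_def T2_def by (intro bounded_clinear_intros T)+
  have LT: "L (T x - (c + t) *\<^sub>C x) = x - t *\<^sub>C L x" for x t
    using L(2)[of x] by (simp add: simps scaleC_add_left algebra_simps)
  have LT1: "L (T1 x) = x - t1 *\<^sub>C L x" and LT2: "L (T2 x) = x - t2 *\<^sub>C L x" for x
    unfolding T1_def T2_def by (rule LT)+
  define P1 where "P1 = (\<lambda>x. x - T1 (R1 (L x)))"
  define P2 where "P2 = (\<lambda>x. x - T2 (R2 (L x)))"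
  have P2: "bounded_clinear P2" unfolding P2_def
    by (intro bounded_clinear_intros bounded_clinear_compose[OF T2] bounded_clinear_compose[OF R(4)] L(1))
  have linv1: "left_inverse (\<lambda>x. R1 (L x)) T1" and linv2: "left_inverse (\<lambda>x. R2 (L x)) T2"
    unfolding left_inverse_def by (auto simp: LT1 LT2 R intro: bounded_clinear_compose R L(1))
  have frP1: "finite_rank P1"
    unfolding P1_def using L' by (intro finite_rank_defect_left_inverse[OF T1 _ linv1, of L'])
      (simp_all add: T1_def)
  \<comment> \<open>The range of \<open>P2\<close> lies in the kernel of \<open>L\<close>, where
    \<open>P1\<close> is the identity.\<close>
  have "P2 x = P1 (P2 x)" for x
    by (simp add: P1_def) (simp add: P2_def simps LT2 R bounded_clinearD[OF T1])
  then have "P2 = (\<lambda>x. P1 (P2 x))" by auto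
  then have frP2: "finite_rank P2" using finite_rank_right[OF frP1 P2] by simp
  show "\<exists>L'. left_inverse L' (\<lambda>x. T x - (c + t2) *\<^sub>C x)
      \<and> finite_rank (\<lambda>x. x - (T (L' x) - (c + t2) *\<^sub>C L' x))"
    using linv2 frP2 by (intro exI[of _ "\<lambda>x. R2 (L x)"]) (simp add: T2_def P2_def)
  have Sb: "bounded_clinear S" "\<And>x. S (T x) = x" using S by (auto simp: left_inverse_def)
  define J where "J = (\<lambda>x. R1 (L (T2 x)))"
  have J: "bounded_clinear J" unfolding J_def
    by (intro bounded_clinear_compose[OF R(1)] bounded_clinear_compose[OF L(1)] T2)
  have "invertible_op J"
  proof (rule invertible_opI)
    show "bounded_clinear (\<lambda>x. R2 (x - t1 *\<^sub>C L x))"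
      by (intro bounded_clinear_compose[OF R(4)] bounded_clinear_intros L(1))
  qed (simp_all add: J_def LT2 R)
  from invertible_op_compose[OF F(2) this]
  have inv: "invertible_op (\<lambda>x. J x - (c + t1) *\<^sub>C S (J x) + F (J x))" .
  have eq: "J x - (c + t1) *\<^sub>C S (J x) + F (J x)
      = x - (c + t2) *\<^sub>C S x + (F (J x) - S (P1 (T2 x)))" for x
  proof -
    have "J x - (c + t1) *\<^sub>C S (J x) = S (T1 (J x))"
      by (simp add: T1_def bounded_clinearD[OF Sb(1)] Sb(2))
    also have "T1 (J x) = T2 x - P1 (T2 x)" by (simp add: P1_def J_def)
    also have "S (T2 x - P1 (T2 x)) = S (T2 x) - S (P1 (T2 x))" by (simp add: bounded_clinearD[OF Sb(1)])
    also have "S (T2 x) = x - (c + t2) *\<^sub>C S x"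
      by (simp add: T2_def bounded_clinearD[OF Sb(1)] Sb(2))
    finally show ?thesis by simp
  qed
  have "finite_rank (\<lambda>x. F (J x) - S (P1 (T2 x)))"
    by (intro finite_rank_diff finite_rank_right[OF F(1) J] finite_rank_left[OF Sb(1)]
        finite_rank_right[OF frP1 T2])
  then show "\<exists>F. finite_rank F \<and> invertible_op (\<lambda>x. x - (c + t2) *\<^sub>C S x + F x)"
    using inv by (intro exI[of _ "\<lambda>x. F (J x) - S (P1 (T2 x))"]) (simp add: eq)
qed

text \<open>Constancy of the Fredholm index in disguise. On \<open>U\<close> only left invertibility
  of \<open>T - c\<close> is given, so the finite rank of the defect has to be transported together
  with the index; the induction carries both.\<close>

lemma index_zero_on_connected:
  fixes T :: "'a::cbanach \<Rightarrow> 'a"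
  assumes T: "bounded_clinear T" and S: "left_inverse S T"
    and fr: "finite_rank (\<lambda>x. x - T (S x))"
    and U: "connected U" "0 \<in> U" "\<And>c. c \<in> U \<Longrightarrow> left_invertible (\<lambda>x. T x - c *\<^sub>C x)"
    and c: "c \<in> U"
  shows "\<exists>F. finite_rank F \<and> invertible_op (\<lambda>x. x - c *\<^sub>C S x + F x)"
proof -
  define P where "P = (\<lambda>c. (\<exists>L. left_inverse L (\<lambda>x. T x - c *\<^sub>C x) \<and> finite_rank (\<lambda>x. x - (T (L x) - c *\<^sub>C L x)))
    \<and> (\<exists>F. finite_rank F \<and> invertible_op (\<lambda>x. x - c *\<^sub>C S x + F x)))"
  have "P c"
  proof (rule connected_induction_simple[OF U(1,2) c])
    show "P 0" unfolding P_def
    proof (intro conjI exI)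
      show "left_inverse S (\<lambda>x. T x - 0 *\<^sub>C x)" "finite_rank (\<lambda>x. x - (T (S x) - 0 *\<^sub>C S x))"
        using S fr by simp_all
      show "finite_rank (\<lambda>x. 0)" by (rule finite_rank.zero)
      show "invertible_op (\<lambda>x. x - 0 *\<^sub>C S x + 0)"
        by (rule invertible_opI[OF bounded_clinear_ident]) simp_all
    qed
    fix c assume "c \<in> U"
    then obtain L where L: "bounded_clinear L" "\<And>x. L (T x - c *\<^sub>C x) = x"
      using U(3)[of c] unfolding left_invertible_iff left_inverse_def by blast
    obtain k where k: "k > 0" "\<And>x. norm (L x) \<le> k * norm x" using bounded_clinear_bound[OF L(1)] by blast
    have inv: "\<exists>R. bounded_clinear R \<and> (\<forall>x. R x - t *\<^sub>C L (R x) = x) \<and> (\<forall>x. R (x - t *\<^sub>C L x) = x)"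
      if t: "cmod t < 1 / (2 * k)" for t
    proof -
      have "norm (t *\<^sub>C L x) \<le> 1 / 2 * norm x" for x
      proof -
        have "cmod t * norm (L x) \<le> 1 / (2 * k) * (k * norm x)"
          using t k by (intro mult_mono) auto
        then show ?thesis using k(1) by (simp add: norm_scaleC)
      qed
      from neumann_inverse[OF bounded_clinear_scale[OF L(1)] this] show ?thesis by auto
    qed
    show "\<exists>W. openin (top_of_set U) W \<and> c \<in> W \<and> (\<forall>x\<in>W. \<forall>y\<in>W. P x \<longrightarrow> P y)"
    proof (intro exI[of _ "U \<inter> ball c (1 / (2 * k))"] conjI ballI impI)
      show "openin (top_of_set U) (U \<inter> ball c (1 / (2 * k)))" by (simp add: openin_open_Int)
      show "c \<in> U \<inter> ball c (1 / (2 * k))" using \<open>c \<in> U\<close> k by simp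
      \<comment> \<open>The transfer joins any two points of the disc by way of the left inverse at
        its centre \<open>c\<close>, where the property itself need not be known.\<close>
      fix x y assume x: "x \<in> U \<inter> ball c (1 / (2 * k))" and y: "y \<in> U \<inter> ball c (1 / (2 * k))" and "P x"
      obtain R1 where R1: "bounded_clinear R1" "\<And>z. R1 z - (x - c) *\<^sub>C L (R1 z) = z"
        "\<And>z. R1 (z - (x - c) *\<^sub>C L z) = z"
        using inv[of "x - c"] x by (auto simp: dist_norm norm_minus_commute)
      obtain R2 where R2: "bounded_clinear R2" "\<And>z. R2 z - (y - c) *\<^sub>C L (R2 z) = z"
        "\<And>z. R2 (z - (y - c) *\<^sub>C L z) = z"
        using inv[of "y - c"] y by (auto simp: dist_norm norm_minus_commute)
      obtain L' F where P: "left_inverse L' (\<lambda>z. T z - x *\<^sub>C z)" "finite_rank (\<lambda>z. z - (T (L' z) - x *\<^sub>C L' z))"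
        "finite_rank F" "invertible_op (\<lambda>z. z - x *\<^sub>C S z + F z)"
        using \<open>P x\<close> unfolding P_def by blast
      have xy: "c + (x - c) = x" "c + (y - c) = y" by simp_all
      note tr = index_zero_transfer[OF T S L R1(1,3,2) R2(1,3,2), unfolded xy, OF P]
      show "P y" unfolding P_def using tr by blast
    qed
  qed
  then show ?thesis by (simp add: P_def)
qed

subsection \<open>The eigenvalues of a left inverse\<close>

definition pencil_injective :: "('a::complex_normed_vector \<Rightarrow> 'a) \<Rightarrow> complex \<Rightarrow> bool" where
  "pencil_injective S c \<longleftrightarrow> (\<forall>x. x - c *\<^sub>C S x = 0 \<longrightarrow> x = 0)"

text \<open>A pole of order at most \<open>p\<close> of the inverse of \<open>I - z S\<close>,
  stated without the inverse. At \<open>z = c\<close> the bound is void unless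
  \<open>p = 0\<close>.\<close>

definition pencil_bound_near :: "('a::complex_normed_vector \<Rightarrow> 'a) \<Rightarrow> complex \<Rightarrow> bool" where
  "pencil_bound_near S c \<longleftrightarrow> (\<exists>(p::nat) k e. k > 0 \<and> e > 0 \<and>
    (\<forall>z x. cmod (z - c) < e \<longrightarrow> k * cmod (z - c) ^ p * norm x \<le> norm (x - z *\<^sub>C S x)))"

lemma pencil_bound_near_isolated:
  assumes "pencil_bound_near S c"
  obtains e where "e > 0" "\<And>z. z \<noteq> c \<Longrightarrow> cmod (z - c) < e \<Longrightarrow> pencil_injective S z"
proof -
  obtain p :: nat and k e where e: "k > 0" "e > 0"
    "\<And>z x. cmod (z - c) < e \<Longrightarrow> k * cmod (z - c) ^ p * norm x \<le> norm (x - z *\<^sub>C S x)"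
    using assms unfolding pencil_bound_near_def by blast
  show ?thesis
  proof (rule that[OF e(2)])
    fix z assume z: "z \<noteq> c" "cmod (z - c) < e"
    have "k * cmod (z - c) ^ p > 0" using e(1) z(1) by simp
    moreover have "k * cmod (z - c) ^ p * norm x \<le> 0" if "x - z *\<^sub>C S x = 0" for x
      using e(3)[OF z(2), of x] that by simp
    ultimately show "pencil_injective S z"
      unfolding pencil_injective_def by (metis mult_pos_pos not_le zero_less_norm_iff)
  qed
qed

text \<open>With \<open>R\<close> inverse to \<open>I - c S + F\<close>, one has
  \<open>R (I - z S) = I - (z - c) R S - R F\<close>, to which the local alternative applies. A
  point where the bound holds has nearby points with injective pencil; this rules out the degenerate
  case and leaves the bound on the whole disc.\<close>

lemma pencil_bound_on_connected:
  fixes S :: "'a::cbanach \<Rightarrow> 'a"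
  assumes S: "bounded_clinear S" and U: "open U" "connected U" "0 \<in> U"
    and ind: "\<And>c. c \<in> U \<Longrightarrow> \<exists>F. finite_rank F \<and> invertible_op (\<lambda>x. x - c *\<^sub>C S x + F x)"
    and c: "c \<in> U"
  shows "pencil_bound_near S c"
proof (rule connected_induction_simple[where P = "pencil_bound_near S", OF U(2,3) c])
  obtain k where k: "k > 0" "\<And>x. norm (S x) \<le> k * norm x" using bounded_clinear_bound[OF S] by blast
  \<comment> \<open>Near \<open>0\<close> the pencil is a small perturbation of the identity, hence
    exponent \<open>0\<close> and constant \<open>1 / 2\<close>.\<close>
  show "pencil_bound_near S 0" unfolding pencil_bound_near_def
  proof (rule exI[of _ 0], rule exI[of _ "1/2"], rule exI[of _ "1 / (2 * k)"], intro conjI allI impI)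
    fix z x assume z: "cmod (z - 0) < 1 / (2 * k)"
    have "cmod z * norm (S x) \<le> 1 / (2 * k) * (k * norm x)"
      using z k by (intro mult_mono) auto
    then have "norm (z *\<^sub>C S x) \<le> norm x / 2" using k(1) by (simp add: norm_scaleC)
    then show "1 / 2 * cmod (z - 0) ^ 0 * norm x \<le> norm (x - z *\<^sub>C S x)"
      using norm_triangle_ineq2[of x "z *\<^sub>C S x"] by simp
  qed (use k in auto)
  fix c assume "c \<in> U"
  then obtain F where F: "finite_rank F" "invertible_op (\<lambda>x. x - c *\<^sub>C S x + F x)" using ind by blast
  from F(2) obtain R where R: "bounded_clinear R" "\<And>x. R (x - c *\<^sub>C S x + F x) = x"
    "\<And>x. R x - c *\<^sub>C S (R x) + F (R x) = x"
    by (rule invertible_opE) blast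
  note Rl = bounded_clinearD[OF R(1)]
  obtain r where r: "r > 0" "\<And>x. norm (R x) \<le> r * norm x" using bounded_clinear_bound[OF R(1)] by blast
  have Rz: "R (x - z *\<^sub>C S x) = x - (z - c) *\<^sub>C R (S x) - R (F x)" for x z
  proof -
    have "R (x - z *\<^sub>C S x) = R ((x - c *\<^sub>C S x + F x) - (z - c) *\<^sub>C S x - F x)"
      by (simp add: complex_vector.scale_left_diff_distrib)
    also have "\<dots> = R (x - c *\<^sub>C S x + F x) - (z - c) *\<^sub>C R (S x) - R (F x)" by (simp only: Rl)
    finally show ?thesis by (simp add: R(2))
  qed
  obtain \<rho> where \<rho>: "\<rho> > 0" and alt: "(\<forall>t. cmod t < \<rho> \<longrightarrow> (\<exists>x. x \<noteq> 0 \<and> x - t *\<^sub>C R (S x) - R (F x) = 0))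
    \<or> (\<forall>s. cmod s < \<rho> \<longrightarrow> (\<exists>(p::nat) k e. k > 0 \<and> e > 0 \<and>
        (\<forall>t x. cmod (t - s) < e \<longrightarrow> k * cmod (t - s) ^ p * norm x \<le> norm (x - t *\<^sub>C R (S x) - R (F x)))))"
    using analytic_fredholm_local[OF bounded_clinear_compose[OF R(1) S] finite_rank_left[OF R(1) F(1)]]
    by blast
  show "\<exists>W. openin (top_of_set U) W \<and> c \<in> W
      \<and> (\<forall>x\<in>W. \<forall>y\<in>W. pencil_bound_near S x \<longrightarrow> pencil_bound_near S y)"
  proof (intro exI[of _ "U \<inter> ball c \<rho>"] conjI ballI impI)
    show "openin (top_of_set U) (U \<inter> ball c \<rho>)" by (simp add: openin_open_Int)
    show "c \<in> U \<inter> ball c \<rho>" using \<open>c \<in> U\<close> \<rho> by simp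
    fix a b assume a: "a \<in> U \<inter> ball c \<rho>" and b: "b \<in> U \<inter> ball c \<rho>" and Pa: "pencil_bound_near S a"
    obtain e where e: "e > 0" "\<And>z. z \<noteq> a \<Longrightarrow> cmod (z - a) < e \<Longrightarrow> pencil_injective S z"
      using pencil_bound_near_isolated[OF Pa] by blast
    obtain e' where e': "e' > 0" "ball a e' \<subseteq> ball c \<rho>"
      using a open_ball open_contains_ball by (metis IntD2)
    \<comment> \<open>A point other than \<open>a\<close>, near enough to \<open>a\<close> for
      injectivity and still in the disc of the alternative.\<close>
    define z where "z = a + of_real (min e e' / 2)"
    have z: "z \<noteq> a" "cmod (z - a) < e" "z \<in> ball a e'"
      using e(1) e'(1) by (auto simp: z_def dist_norm)
    then have "pencil_injective S z" "cmod (z - c) < \<rho>"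
      using e(2) e'(2) by (auto simp: dist_norm norm_minus_commute)
    have "x = 0" if "x - (z - c) *\<^sub>C R (S x) - R (F x) = 0" for x
    proof -
      have "R (x - z *\<^sub>C S x) = 0" using that Rz by simp
      then have "x - z *\<^sub>C S x = 0"
        using R(3)[of "x - z *\<^sub>C S x"] bounded_clinearD(5)[OF S]
          bounded_clinearD(5)[OF finite_rank_bounded_clinear[OF F(1)]] by simp
      then show ?thesis using \<open>pencil_injective S z\<close> by (simp add: pencil_injective_def)
    qed
    then have "\<forall>s. cmod s < \<rho> \<longrightarrow> (\<exists>(p::nat) k e. k > 0 \<and> e > 0 \<and>
        (\<forall>t x. cmod (t - s) < e \<longrightarrow> k * cmod (t - s) ^ p * norm x \<le> norm (x - t *\<^sub>C R (S x) - R (F x))))"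
      using alt \<open>cmod (z - c) < \<rho>\<close> by blast
    then have "\<exists>(p::nat) k e. k > 0 \<and> e > 0 \<and> (\<forall>t x. cmod (t - (b - c)) < e \<longrightarrow>
        k * cmod (t - (b - c)) ^ p * norm x \<le> norm (x - t *\<^sub>C R (S x) - R (F x)))"
      by (elim allE[of _ "b - c"] impE) (use b in \<open>simp_all add: dist_norm norm_minus_commute\<close>)
    then obtain p :: nat and k e where kp: "k > 0" "e > 0"
      "\<forall>t x. cmod (t - (b - c)) < e \<longrightarrow> k * cmod (t - (b - c)) ^ p * norm x \<le> norm (x - t *\<^sub>C R (S x) - R (F x))"
      by (elim exE conjE) (rule that)
    show "pencil_bound_near S b" unfolding pencil_bound_near_def
    proof (rule exI[of _ p], rule exI[of _ "k / r"], rule exI[of _ e], intro conjI allI impI)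
      fix z x assume "cmod (z - b) < e"
      then have "k * cmod (z - b) ^ p * norm x \<le> norm (R (x - z *\<^sub>C S x))"
        using kp(3)[rule_format, of "z - c" x] by (simp add: Rz)
      also have "\<dots> \<le> r * norm (x - z *\<^sub>C S x)" by (rule r(2))
      finally show "k / r * cmod (z - b) ^ p * norm x \<le> norm (x - z *\<^sub>C S x)"
        using r(1) by (simp add: field_simps)
    qed (use kp r in auto)
  qed
qed

text \<open>An accumulation point would lie in the compact set \<open>D\<close>, where the bound
  excludes it.\<close>

lemma finite_noninjective:
  assumes "compact D" "\<And>c. c \<in> D \<Longrightarrow> pencil_bound_near S c"
  shows "finite {c \<in> D. \<not> pencil_injective S c}"
proof (rule ccontr)
  assume "infinite {c \<in> D. \<not> pencil_injective S c}"
  moreover have "{c \<in> D. \<not> pencil_injective S c} \<subseteq> D" by auto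
  ultimately obtain c where c: "c \<in> D" "c islimpt {c \<in> D. \<not> pencil_injective S c}"
    using assms(1) unfolding compact_eq_Bolzano_Weierstrass by blast
  obtain e where e: "e > 0" "\<And>z. z \<noteq> c \<Longrightarrow> cmod (z - c) < e \<Longrightarrow> pencil_injective S z"
    using pencil_bound_near_isolated[OF assms(2)[OF c(1)]] by blast
  obtain z where "\<not> pencil_injective S z" "z \<noteq> c" "dist z c < e"
    using c(2) e(1) unfolding islimpt_approachable by blast
  then show False using e(2) by (simp add: dist_norm)
qed

section \<open>Jordan chains and algebraic multiplicity\<close>

abbreviation pencil :: "('a::complex_normed_vector \<Rightarrow> 'a) \<Rightarrow> complex \<Rightarrow> 'a \<Rightarrow> 'a" where
  "pencil S c \<equiv> \<lambda>x. x - c *\<^sub>C S x"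

lemma bounded_clinear_pencil: "bounded_clinear S \<Longrightarrow> bounded_clinear (pencil S c)"
  by (intro bounded_clinear_intros)

lemma tendsto_scaleC_left:
  fixes v :: "'a::complex_normed_vector"
  assumes "(f \<longlongrightarrow> c) F" shows "((\<lambda>t. f t *\<^sub>C v) \<longlongrightarrow> c *\<^sub>C v) F"
proof -
  have "((\<lambda>t. norm (f t - c) * norm v) \<longlongrightarrow> 0) F"
    using assms by (intro tendsto_mult_left_zero tendsto_norm_zero LIM_zero)
  then have "((\<lambda>t. f t *\<^sub>C v - c *\<^sub>C v) \<longlongrightarrow> 0) F"
    by (rule Lim_null_comparison[rotated])
      (simp add: complex_vector.scale_left_diff_distrib[symmetric] norm_scaleC)
  then show ?thesis by (rule LIM_zero_cancel)
qed

text \<open>A Jordan chain of length \<open>n + 1\<close> at \<open>c\<close> yields vectors that the pencil at \<open>c + t\<close> makes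
  smaller by a factor of order \<open>t ^ (n + 1)\<close>.\<close>

lemma pencil_chain_length:
  fixes S :: "'a::complex_normed_vector \<Rightarrow> 'a"
  assumes S: "bounded_clinear S" and c: "c \<noteq> 0" and k: "k > 0" "e > 0"
    and low: "\<And>z x. cmod (z - c) < e \<Longrightarrow> k * cmod (z - c) ^ p * norm x \<le> norm (x - z *\<^sub>C S x)"
    and n: "p \<le> n" and x: "(pencil S c ^^ Suc n) x = 0"
  shows "(pencil S c ^^ n) x = 0"
proof -
  define N where "N = pencil S c"
  have N: "bounded_clinear N" unfolding N_def by (rule bounded_clinear_pencil[OF S])
  note Nl = bounded_clinearD[OF N]
  \<comment> \<open>With \<open>z = c + t\<close>, \<open>c (I - z S) = z N - t I\<close>. The
    vector \<open>w n t\<close> is the geometric sum for which \<open>z N - t I\<close> yields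
    \<open>(z N) ^ (n + 1) x - t ^ (n + 1) x\<close>; on the given chain only the second term
    remains.\<close>
  define w where "w = (\<lambda>n t. \<Sum>j\<le>n. (t ^ (n - j) * (c + t) ^ j) *\<^sub>C (N ^^ j) x)"
  have wrec: "w (Suc n) t = t *\<^sub>C w n t + (c + t) ^ Suc n *\<^sub>C (N ^^ Suc n) x" for n t
  proof -
    have "(\<Sum>j\<le>n. (t ^ (Suc n - j) * (c + t) ^ j) *\<^sub>C (N ^^ j) x) = t *\<^sub>C w n t"
      unfolding w_def complex_vector.scale_sum_right
      by (rule sum.cong) (auto simp: Suc_diff_le scaleC_scaleC mult.assoc)
    then show ?thesis by (simp add: w_def)
  qed
  have tele: "(c + t) *\<^sub>C N (w n t) - t *\<^sub>C w n t
      = (c + t) ^ Suc n *\<^sub>C (N ^^ Suc n) x - t ^ Suc n *\<^sub>C x" for n t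
  proof (induction n)
    case 0
    show ?case by (simp add: w_def scaleC_one)
  next
    case (Suc n)
    have "(c + t) *\<^sub>C N (w (Suc n) t) - t *\<^sub>C w (Suc n) t
      = t *\<^sub>C ((c + t) *\<^sub>C N (w n t) - t *\<^sub>C w n t)
        + (c + t) ^ Suc (Suc n) *\<^sub>C (N ^^ Suc (Suc n)) x - t *\<^sub>C (c + t) ^ Suc n *\<^sub>C (N ^^ Suc n) x"
      unfolding wrec
      by (simp add: Nl scaleC_add_right complex_vector.scale_right_diff_distrib scaleC_scaleC mult_ac)
    then show ?case unfolding Suc
      by (simp add: complex_vector.scale_right_diff_distrib scaleC_scaleC)
  qed
  have cS: "c *\<^sub>C (y - (c + t) *\<^sub>C S y) = (c + t) *\<^sub>C N y - t *\<^sub>C y" for y t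
    by (simp add: N_def complex_vector.scale_right_diff_distrib scaleC_add_left scaleC_scaleC algebra_simps)
  have bound: "k * cmod c * norm (w n t) \<le> cmod t * norm x"
    if t: "t \<noteq> 0" "cmod t < min e 1" for t
  proof -
    have "c *\<^sub>C (w n t - (c + t) *\<^sub>C S (w n t)) = - (t ^ Suc n *\<^sub>C x)"
      unfolding cS tele using x by (simp add: N_def)
    then have "cmod c * norm (w n t - (c + t) *\<^sub>C S (w n t)) = cmod t ^ Suc n * norm x"
      by (metis norm_minus_cancel norm_power norm_scaleC)
    moreover have "k * cmod t ^ p * norm (w n t) \<le> norm (w n t - (c + t) *\<^sub>C S (w n t))"
      using low[of "c + t" "w n t"] t by simp
    ultimately have "cmod c * (k * cmod t ^ p * norm (w n t)) \<le> cmod t ^ Suc n * norm x"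
      by (metis mult_left_mono norm_ge_zero)
    \<comment> \<open>Here \<open>p \<le> n\<close> enters: after cancelling \<open>|t| ^ p\<close>
      one factor \<open>|t|\<close> is left, which forces the limit of \<open>w n t\<close> to
      vanish.\<close>
    also have "cmod t ^ Suc n \<le> cmod t ^ Suc p" using n t by (intro power_decreasing) auto
    then have "cmod t ^ Suc n * norm x \<le> cmod t ^ Suc p * norm x" by (rule mult_right_mono) simp
    finally have "cmod t ^ p * (k * cmod c * norm (w n t)) \<le> cmod t ^ p * (cmod t * norm x)"
      by (simp add: mult_ac)
    then show ?thesis using t by (simp add: mult_le_cancel_left_pos)
  qed
  have "((\<lambda>t. w n t) \<longlongrightarrow> (\<Sum>j\<le>n. (0 ^ (n - j) * (c + 0) ^ j) *\<^sub>C (N ^^ j) x)) (at 0)"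
    unfolding w_def by (intro tendsto_sum tendsto_scaleC_left tendsto_intros)
  \<comment> \<open>Only \<open>j = n\<close> survives, where \<open>0 ^ 0 = 1\<close>.\<close>
  also have "(\<Sum>j\<le>n. (0 ^ (n - j) * (c + 0) ^ j) *\<^sub>C (N ^^ j) x) = (\<Sum>j\<in>{n}. c ^ n *\<^sub>C (N ^^ n) x)"
    by (rule sum.mono_neutral_cong_right) auto
  finally have "((\<lambda>t. w n t) \<longlongrightarrow> c ^ n *\<^sub>C (N ^^ n) x) (at 0)" by simp
  then have lim: "((\<lambda>t. k * cmod c * norm (w n t)) \<longlongrightarrow> k * cmod c * norm (c ^ n *\<^sub>C (N ^^ n) x)) (at 0)"
    by (intro tendsto_intros)
  have lim0: "((\<lambda>t::complex. cmod t * norm x) \<longlongrightarrow> 0 * norm x) (at 0)"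
    by (intro tendsto_mult_right tendsto_norm_zero tendsto_ident_at)
  have "\<forall>\<^sub>F t in at 0. k * cmod c * norm (w n t) \<le> cmod t * norm x"
    unfolding eventually_at using bound k(2) by (intro exI[of _ "min e 1"]) auto
  from tendsto_le[OF _ lim0 lim this] have "k * cmod c * norm (c ^ n *\<^sub>C (N ^^ n) x) \<le> 0" by simp
  then have "norm (c ^ n *\<^sub>C (N ^^ n) x) \<le> 0" using k(1) c by (simp add: mult_le_0_iff)
  then show ?thesis using c by (simp add: N_def)
qed

text \<open>A left inverse of the power modulo finite rank. It confines the kernel of that power:
  there \<open>x\<close> equals its image under a finite rank operator. Each induction step composes
  with the inverse \<open>Q\<close> of the corrected pencil, for which \<open>Q N = I - Q F\<close>
  with \<open>N = pencil S c\<close>.\<close>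

lemma pencil_power_parametrix:
  fixes S :: "'a::cbanach \<Rightarrow> 'a"
  assumes S: "bounded_clinear S" and F: "finite_rank F" "invertible_op (\<lambda>x. x - c *\<^sub>C S x + F x)"
  shows "\<exists>R. bounded_clinear R \<and> finite_rank (\<lambda>x. x - R ((pencil S c ^^ n) x))"
proof (induction n)
  case 0
  show ?case by (intro exI[of _ "\<lambda>x. x"]) (simp add: bounded_clinear_ident finite_rank.zero)
next
  case (Suc n)
  then obtain R where R: "bounded_clinear R" "finite_rank (\<lambda>x. x - R ((pencil S c ^^ n) x))" by blast
  from F(2) obtain Q where Q: "bounded_clinear Q" "\<And>x. Q (x - c *\<^sub>C S x + F x) = x"
    by (rule invertible_opE) blast
  have N: "bounded_clinear (pencil S c)" by (rule bounded_clinear_pencil[OF S])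
  have "x - Q (R ((pencil S c ^^ Suc n) x))
      = Q (F x) + Q (pencil S c x - R ((pencil S c ^^ n) (pencil S c x)))" for x
  proof -
    have "Q (F x) + Q (pencil S c x) = x" using Q(2)[of x] by (simp add: bounded_clinearD[OF Q(1)] add.commute)
    moreover have "Q (pencil S c x - y) = Q (pencil S c x) - Q y" for y
      by (rule bounded_clinearD(3)[OF Q(1)])
    ultimately show ?thesis by (simp only: add_diff_eq funpow_Suc_right comp_apply)
  qed
  moreover have "finite_rank (\<lambda>x. Q (F x) + Q (pencil S c x - R ((pencil S c ^^ n) (pencil S c x))))"
    by (intro finite_rank_add finite_rank_left[OF Q(1)] F(1) finite_rank_right[OF R(2) N])
  ultimately show ?case using bounded_clinear_compose[OF Q(1) R(1)]
    by (intro exI[of _ "\<lambda>x. Q (R x)"]) simp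
qed

text \<open>For nonzero \<open>c\<close> this is the generalised eigenspace of \<open>S\<close> at
  \<open>1 / c\<close>; its dimension is the multiplicity that deflation lowers.\<close>

definition root_space :: "('a::complex_normed_vector \<Rightarrow> 'a) \<Rightarrow> complex \<Rightarrow> 'a set" where
  "root_space S c = {x. \<exists>n. (pencil S c ^^ n) x = 0}"

text \<open>The exponent \<open>p\<close> of the bound stops Jordan chains, so the root space is the
  kernel of the \<open>p\<close>-th power, and the parametrix of that power places it in a
  finite-dimensional range.\<close>

lemma root_space_finite_dim:
  fixes S :: "'a::cbanach \<Rightarrow> 'a"
  assumes S: "bounded_clinear S" and c: "c \<noteq> 0" and b: "pencil_bound_near S c"
    and F: "finite_rank F" "invertible_op (\<lambda>x. x - c *\<^sub>C S x + F x)"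
  obtains B where "finite B" "root_space S c \<subseteq> cspan B"
proof -
  obtain p :: nat and k e where e: "k > 0" "e > 0"
    "\<And>z x. cmod (z - c) < e \<Longrightarrow> k * cmod (z - c) ^ p * norm x \<le> norm (x - z *\<^sub>C S x)"
    using b unfolding pencil_bound_near_def by blast
  obtain R where R: "bounded_clinear R" "finite_rank (\<lambda>x. x - R ((pencil S c ^^ p) x))"
    using pencil_power_parametrix[OF S F] by blast
  obtain B where B: "finite B" "range (\<lambda>x. x - R ((pencil S c ^^ p) x)) \<subseteq> cspan B"
    using finite_rank_range[OF R(2)] by blast
  have stab: "(pencil S c ^^ p) x = 0" if "(pencil S c ^^ (p + i)) x = 0" for i x
    using that
  proof (induction i)
    case (Suc i)
    have "(pencil S c ^^ Suc (p + i)) x = 0" using Suc.prems by simp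
    from pencil_chain_length[OF S c e le_add1 this] show ?case by (rule Suc.IH)
  qed simp
  have "x \<in> cspan B" if x: "x \<in> root_space S c" for x
  proof -
    obtain n where "(pencil S c ^^ n) x = 0" using x by (auto simp: root_space_def)
    then have "(pencil S c ^^ (p + n)) x = 0"
      using bounded_clinearD(5)[OF bounded_clinear_funpow[OF bounded_clinear_pencil[OF S]]]
      by (simp add: funpow_add)
    then have "(pencil S c ^^ p) x = 0" by (rule stab)
    then have "x - R ((pencil S c ^^ p) x) = x" by (simp add: bounded_clinearD[OF R(1)])
    then show ?thesis using subsetD[OF B(2) rangeI, of x] by simp
  qed
  then show ?thesis by (intro that[OF B(1)] subsetI)
qed

subsection \<open>Deflation\<close>

lemma subspace_root_space:
  assumes S: "bounded_clinear S" shows "complex_vector.subspace (root_space S c)"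
proof (rule complex_vector.subspaceI)
  note N = bounded_clinear_pencil[OF S, of c]
  note Nl = bounded_clinearD[OF bounded_clinear_funpow[OF N]]
  have shift: "(pencil S c ^^ (i + n)) x = 0" if "(pencil S c ^^ n) x = 0" for i n x
    using that by (simp add: funpow_add Nl)
  show "0 \<in> root_space S c" by (simp add: root_space_def Nl)
  show "d *\<^sub>C x \<in> root_space S c" if "x \<in> root_space S c" for d x
    using that by (auto simp: root_space_def Nl)
  fix x y assume "x \<in> root_space S c" "y \<in> root_space S c"
  then obtain i j where "(pencil S c ^^ i) x = 0" "(pencil S c ^^ j) y = 0"
    by (auto simp: root_space_def)
  then have "(pencil S c ^^ (i + j)) (x + y) = 0"
    using shift[of i x j] shift[of j y i] by (simp add: Nl add.commute)
  then show "x + y \<in> root_space S c" by (auto simp: root_space_def)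
qed

text \<open>Brauer's rank one deflation: the eigenvector \<open>e\<close> is moved to the eigenvalue \<open>0\<close>, and
  the new operator induces the same operator on the quotient by \<open>e\<close>.\<close>

lemma deflation:
  fixes S :: "'a::complex_normed_vector \<Rightarrow> 'a"
  assumes S: "bounded_clinear S" and e: "e \<noteq> 0" "e = c *\<^sub>C S e" and c: "c \<noteq> 0"
    and f: "bounded_cfunctional f" "f e = - 1 / c"
  defines "S' \<equiv> \<lambda>x. S x + f x *\<^sub>C e"
  shows "root_space S' c \<subseteq> root_space S c" "e \<in> root_space S c" "e \<notin> root_space S' c"
    "\<And>z. z \<noteq> c \<Longrightarrow> pencil_injective S z \<Longrightarrow> pencil_injective S' z"
proof -
  note Sl = bounded_clinearD[OF S] and fl = bounded_cfunctionalD[OF f(1)]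
  have S': "bounded_clinear S'"
    unfolding S'_def by (intro bounded_clinear_add S bounded_clinear_rank_one f)
  have Se: "S e = (1 / c) *\<^sub>C e"
  proof -
    have "(1 / c) *\<^sub>C e = (1 / c) *\<^sub>C c *\<^sub>C S e" using e(2) by simp
    then show ?thesis using c by (simp add: scaleC_scaleC scaleC_one)
  qed
  have S'e: "S' e = 0" by (simp add: S'_def Se f(2))
  show er: "e \<in> root_space S c"
    unfolding root_space_def using e(2) by (auto intro!: exI[of _ 1])
  have "(pencil S' c ^^ n) e = e" for n
    by (induction n) (simp_all add: S'e)
  then show "e \<notin> root_space S' c" using e(1) by (simp add: root_space_def)
  have Ne: "pencil S c e = 0" using e(2) by simp
  have "\<exists>m. (pencil S c ^^ m) x = 0" if "(pencil S' c ^^ n) x = 0" for n x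
    using that
  proof (induction n arbitrary: x)
    case (Suc n)
    then have "(pencil S' c ^^ n) (pencil S' c x) = 0" by (simp only: funpow_Suc_right comp_apply)
    then obtain m where m: "(pencil S c ^^ m) (pencil S' c x) = 0" using Suc.IH by blast
    have "bounded_clinear (pencil S c ^^ Suc m)"
      by (intro bounded_clinear_funpow bounded_clinear_pencil S)
    note Pl = bounded_clinearD[OF this]
    \<comment> \<open>The pencils differ by a multiple of \<open>e\<close>, which the old pencil
      annihilates; one extra power therefore absorbs it.\<close>
    have "pencil S c x = pencil S' c x + (c * f x) *\<^sub>C e"
      by (simp add: S'_def scaleC_add_right scaleC_scaleC)
    then have "(pencil S c ^^ Suc m) (pencil S c x)
        = (pencil S c ^^ Suc m) (pencil S' c x) + (c * f x) *\<^sub>C (pencil S c ^^ Suc m) e"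
      by (simp only: Pl)
    also have "(pencil S c ^^ Suc m) (pencil S' c x) = 0"
      using m by (simp add: Sl)
    also have "(pencil S c ^^ Suc m) e = (pencil S c ^^ m) (pencil S c e)"
      by (simp only: funpow_Suc_right comp_apply)
    also have "\<dots> = 0"
      unfolding Ne by (rule bounded_clinearD(5)[OF bounded_clinear_funpow[OF bounded_clinear_pencil[OF S]]])
    finally have "(pencil S c ^^ Suc (Suc m)) x = 0" by (simp only: funpow_Suc_right comp_apply) simp
    then show ?case by blast
  qed (auto intro: exI[of _ 0])
  then show "root_space S' c \<subseteq> root_space S c" by (auto simp: root_space_def)
  fix z assume z: "z \<noteq> c" "pencil_injective S z"
  show "pencil_injective S' z" unfolding pencil_injective_def
  proof (intro allI impI)
    fix x assume x: "x - z *\<^sub>C S' x = 0"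
    \<comment> \<open>Chosen so that \<open>x + d e\<close> lies in the kernel of
      \<open>I - z S\<close>. Injectivity then makes \<open>x\<close> a multiple of
      \<open>e\<close>, which \<open>S'\<close> annihilates, so
      \<open>x = z S' x = 0\<close>.\<close>
    define d where "d = - (z * f x) / (1 - z / c)"
    have "1 - z / c \<noteq> 0" using z(1) c by (simp add: field_simps)
    then have d: "d * (1 - z / c) = - (z * f x)" by (simp add: d_def)
    have "(x + d *\<^sub>C e) - z *\<^sub>C S (x + d *\<^sub>C e)
        = (x - z *\<^sub>C S' x) + (z * f x + d * (1 - z / c)) *\<^sub>C e"
      by (simp add: S'_def Sl Se scaleC_add_right scaleC_add_left scaleC_scaleC algebra_simps
          complex_vector.scale_left_diff_distrib)
    also have "\<dots> = 0" using x d by simp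
    finally have "x = (- d) *\<^sub>C e" using z(2) by (simp add: pencil_injective_def eq_neg_iff_add_eq_0)
    then have "S' x = (- d) *\<^sub>C S' e" by (simp add: bounded_clinearD[OF S'])
    then show "x = 0" using x S'e by simp
  qed
qed

text \<open>The functional is a coefficient of a finite rank representation of the projection
  \<open>P = I - T S\<close>, precomposed with \<open>P\<close> so that it vanishes on the range of
  \<open>T\<close>, and rescaled. Since \<open>P (P e) = P e\<close> is nonzero, some coefficient
  does not vanish at \<open>P e\<close>.\<close>

lemma deflation_functional:
  assumes T: "bounded_clinear T" and S: "left_inverse S T" and fr: "finite_rank (\<lambda>x. x - T (S x))"
    and inv: "left_invertible (\<lambda>x. T x - c *\<^sub>C x)" and e: "e \<noteq> 0" "e = c *\<^sub>C S e" and c: "c \<noteq> 0"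
  obtains f where "bounded_cfunctional f" "f e = - 1 / c" "\<And>x. f (T x) = 0"
proof -
  have Sb: "bounded_clinear S" "\<And>x. S (T x) = x" using S by (auto simp: left_inverse_def)
  define P where "P = (\<lambda>x. x - T (S x))"
  have P: "bounded_clinear P" unfolding P_def
    by (intro bounded_clinear_diff bounded_clinear_ident bounded_clinear_compose[OF T Sb(1)])
  have PP: "P (P x) = P x" and PT: "P (T x) = 0" for x
    by (simp_all add: P_def bounded_clinearD[OF T] bounded_clinearD[OF Sb(1)] Sb(2))
  have "P e \<noteq> 0"
  proof
    assume "P e = 0"
    then have "e = T (S e)" by (simp add: P_def)
    then have "c *\<^sub>C e = c *\<^sub>C T (S e)" by (rule arg_cong)
    then have "c *\<^sub>C e = T (c *\<^sub>C S e)" by (simp only: bounded_clinearD(4)[OF T])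
    then have 0: "T e - c *\<^sub>C e = 0" using e(2) by simp
    obtain L where L: "bounded_clinear L" "\<And>x. L (T x - c *\<^sub>C x) = x"
      using inv unfolding left_invertible_iff left_inverse_def by blast
    show False using L(2)[of e] e(1) unfolding 0 by (simp add: bounded_clinearD(5)[OF L(1)])
  qed
  obtain m :: nat and f u where f: "\<forall>i<m. bounded_cfunctional (f i)"
    and Px: "\<forall>x. P x = (\<Sum>i<m. f i x *\<^sub>C u i)"
    using finite_rank_sum_form[OF fr] unfolding P_def by blast
  have "\<exists>i<m. f i (P e) \<noteq> 0"
  proof (rule ccontr)
    assume "\<not> (\<exists>i<m. f i (P e) \<noteq> 0)"
    then have "P (P e) = 0" using Px by simp
    with PP \<open>P e \<noteq> 0\<close> show False by simp
  qed
  then obtain i where i: "i < m" "f i (P e) \<noteq> 0" by blast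
  show ?thesis
  proof (rule that)
    show "bounded_cfunctional (\<lambda>x. (- 1 / (c * f i (P e))) * f i (P x))"
      using f i(1) by (intro bounded_cfunctional_scale bounded_cfunctional_compose[OF _ P]) auto
    show "(- 1 / (c * f i (P e))) * f i (P e) = - 1 / c" using i(2) by simp
    show "(- 1 / (c * f i (P e))) * f i (P (T x)) = 0" for x
      using f i(1) by (simp add: PT bounded_cfunctionalD(5))
  qed
qed

text \<open>Induction on a bound for the dimension of the root space, phrased through independent
  sets because the ambient space may be infinite-dimensional. Each deflation changes
  \<open>S\<close>, so the finite rank of the defect is required for all left inverses.\<close>

lemma remove_eigenvalue:
  fixes T :: "'a::complex_normed_vector \<Rightarrow> 'a"
  assumes T: "bounded_clinear T"
    and fr: "\<And>S. left_inverse S T \<Longrightarrow> finite_rank (\<lambda>x. x - T (S x))"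
    and inv: "left_invertible (\<lambda>x. T x - c *\<^sub>C x)" and c: "c \<noteq> 0"
    and S: "left_inverse S T"
    and dim: "\<And>C. C \<subseteq> root_space S c \<Longrightarrow> complex_vector.independent C \<Longrightarrow> finite C \<and> card C \<le> n"
  shows "\<exists>S'. left_inverse S' T \<and> pencil_injective S' c
    \<and> (\<forall>z. z \<noteq> c \<longrightarrow> pencil_injective S z \<longrightarrow> pencil_injective S' z)"
  using S dim
proof (induction n arbitrary: S)
  case (0 S)
  have "pencil_injective S c" unfolding pencil_injective_def
  proof (intro allI impI, rule ccontr)
    fix e assume e: "e - c *\<^sub>C S e = 0" "e \<noteq> 0"
    have "{e} \<subseteq> root_space S c" using e(1) by (auto simp: root_space_def intro!: exI[of _ 1])
    moreover have "complex_vector.independent {e}" using e(2) by simp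
    ultimately show False using 0(2)[of "{e}"] by auto
  qed
  then show ?case using 0(1) by blast
next
  case (Suc n S)
  show ?case
  proof (cases "pencil_injective S c")
    case True
    then show ?thesis using Suc.prems(1) by blast
  next
    case False
    then obtain e where e: "e \<noteq> 0" "e = c *\<^sub>C S e" by (auto simp: pencil_injective_def)
    have Sb: "bounded_clinear S" "\<And>x. S (T x) = x" using Suc.prems(1) by (auto simp: left_inverse_def)
    obtain f where f: "bounded_cfunctional f" "f e = - 1 / c" "\<And>x. f (T x) = 0"
      using deflation_functional[OF T Suc.prems(1) fr[OF Suc.prems(1)] inv e c] by blast
    define S' where "S' = (\<lambda>x. S x + f x *\<^sub>C e)"
    note d = deflation[OF Sb(1) e c f(1,2), folded S'_def]
    have S': "left_inverse S' T" unfolding left_inverse_def S'_def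
      by (auto simp: Sb(2) f(3) intro!: bounded_clinear_add Sb(1) bounded_clinear_rank_one f(1))
    have "finite C \<and> card C \<le> n" if C: "C \<subseteq> root_space S' c" "complex_vector.independent C" for C
    proof -
      have "bounded_clinear S'" using S' by (simp add: left_inverse_def)
      \<comment> \<open>The new root space is a subspace without \<open>e\<close>, so
        \<open>e\<close> can be added to any independent set in it; inside the old root space this
        costs one dimension.\<close>
      then have "cspan C \<subseteq> root_space S' c"
        using C(1) subspace_root_space by (intro complex_vector.span_minimal)
      then have e: "e \<notin> cspan C" "e \<notin> C" using d(3) C(1) by auto
      then have "complex_vector.independent (insert e C)"
        using C(2) by (simp add: complex_vector.independent_insert)
      moreover have "insert e C \<subseteq> root_space S c" using C(1) d(1,2) by blast
      ultimately have "finite (insert e C) \<and> card (insert e C) \<le> Suc n" by (intro Suc.prems(2))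
      then have "finite C" "card (insert e C) \<le> Suc n" by simp_all
      then show ?thesis using e(2) by simp
    qed
    from Suc.IH[OF S' this] d(4) show ?thesis by blast
  qed
qed

section \<open>Left inverses without bad points in a closed disc\<close>

lemma finite_rank_defect:
  fixes T :: "'a::cbanach \<Rightarrow> 'a"
  assumes T: "bounded_clinear T" and S: "left_inverse S T" and fred: "fredholm T"
  shows "finite_rank (\<lambda>x. x - T (S x))"
proof -
  have Sb: "bounded_clinear S" "\<And>x. S (T x) = x" using S by (auto simp: left_inverse_def)
  obtain B where B: "finite B" "\<And>x. \<exists>b \<in> cspan B. x - b \<in> range T"
    using fred unfolding fredholm_def by blast
  define P where "P = (\<lambda>x. x - T (S x))"
  have P: "bounded_clinear P" unfolding P_def
    by (intro bounded_clinear_diff bounded_clinear_ident bounded_clinear_compose[OF T Sb(1)])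
  note Pl = bounded_clinearD[OF P]
  have "complex_vector.subspace {b. P b \<in> cspan (P ` B)}"
    by (rule complex_vector.subspaceI)
      (auto simp: Pl intro: complex_vector.span_add complex_vector.span_scale complex_vector.span_zero)
  then have sub: "cspan B \<subseteq> {b. P b \<in> cspan (P ` B)}"
    by (intro complex_vector.span_minimal) (auto intro: complex_vector.span_base)
  \<comment> \<open>\<open>P\<close> vanishes on the range of \<open>T\<close>, so its own range is
    spanned by the images of the finitely many representatives of the quotient.\<close>
  have "range P \<subseteq> cspan (P ` B)"
  proof
    fix y assume "y \<in> range P"
    then obtain x where "y = P x" by blast
    obtain b z where b: "b \<in> cspan B" "x - b = T z" using B(2)[of x] by blast
    have "P x - P b = P (T z)" using b(2) by (simp add: Pl(3)[symmetric])
    also have "\<dots> = 0" by (simp add: P_def Sb(2))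
    finally show "y \<in> cspan (P ` B)" using b(1) sub \<open>y = P x\<close> by auto
  qed
  then have "finite_rank P" using B(1) P by (intro finite_rank_if_range_finite[of "P ` B"]) auto
  then show ?thesis by (simp add: P_def)
qed

lemma left_inverse_small_spectrum:
  fixes T :: "'a::cbanach \<Rightarrow> 'a"
  assumes T: "bounded_clinear T" and fred: "fredholm T"
    and inv: "\<And>c. cmod c < \<rho> \<Longrightarrow> left_invertible (\<lambda>x. T x - c *\<^sub>C x)"
    and r: "0 < r" "r < \<rho>"
  obtains S where "left_inverse S T" "\<And>c. cmod c \<le> r \<Longrightarrow> invertible_op (\<lambda>x. x - c *\<^sub>C S x)"
proof -
  define U :: "complex set" where "U = ball 0 \<rho>"
  have U: "open U" "connected U" "0 \<in> U" "\<And>c. c \<in> U \<Longrightarrow> left_invertible (\<lambda>x. T x - c *\<^sub>C x)"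
    using inv r by (auto simp: U_def)
  have fr: "finite_rank (\<lambda>x. x - T (S x))" if "left_inverse S T" for S
    by (rule finite_rank_defect[OF T that fred])
  have ind: "\<exists>F. finite_rank F \<and> invertible_op (\<lambda>x. x - c *\<^sub>C S x + F x)"
    if "left_inverse S T" "c \<in> U" for S c
    by (rule index_zero_on_connected[OF T that(1) fr[OF that(1)] U(2,3,4) that(2)])
  have near: "pencil_bound_near S c" if "left_inverse S T" "c \<in> U" for S c
    using that(1) by (intro pencil_bound_on_connected[OF _ U(1,2,3) ind[OF that(1)] that(2)])
      (auto simp: left_inverse_def)
  obtain S0 where S0: "left_inverse S0 T"
    using inv[of 0] r by (auto simp: left_invertible_iff)
  define Z where "Z = {c \<in> cball 0 r. \<not> pencil_injective S0 c}"
  have Z: "finite Z" unfolding Z_def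
    by (rule finite_noninjective[OF compact_cball near[OF S0]]) (use r in \<open>auto simp: U_def\<close>)
  \<comment> \<open>Generalised over the finite set and the left inverse: \<open>S\<close> changes
    with every removal, and since deflation creates no new bad points the set only shrinks.\<close>
  have remove_all: "\<exists>S'. left_inverse S' T \<and> (\<forall>c\<in>cball 0 r. pencil_injective S' c)"
    if "finite Z" "Z \<subseteq> U" "left_inverse S T" "\<forall>c\<in>cball 0 r - Z. pencil_injective S c" for Z S
    using that
  proof (induction Z arbitrary: S rule: finite_induct)
    case (insert c Z)
    show ?case
    proof (cases "pencil_injective S c")
      case True
      then show ?thesis using insert by blast
    next
      case False
      then have "c \<noteq> 0" by (auto simp: pencil_injective_def)
      have c: "c \<in> U" using insert.prems(1) by simp
      have Sb: "bounded_clinear S" using insert.prems(2) by (simp add: left_inverse_def)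
      obtain F where F: "finite_rank F" "invertible_op (\<lambda>x. x - c *\<^sub>C S x + F x)"
        using ind[OF insert.prems(2) c] by blast
      obtain B where B: "finite B" "root_space S c \<subseteq> cspan B"
        using root_space_finite_dim[OF Sb \<open>c \<noteq> 0\<close> near[OF insert.prems(2) c] F] by blast
      have "finite C \<and> card C \<le> card B"
        if "C \<subseteq> root_space S c" "complex_vector.independent C" for C
        using that B by (intro complex_vector.independent_span_bound) auto
      from remove_eigenvalue[OF T fr U(4)[OF c] \<open>c \<noteq> 0\<close> insert.prems(2) this]
      obtain S' where S': "left_inverse S' T" "pencil_injective S' c"
        "\<forall>z. z \<noteq> c \<longrightarrow> pencil_injective S z \<longrightarrow> pencil_injective S' z" by blast
      show ?thesis
      proof (rule insert.IH)
        show "\<forall>c\<in>cball 0 r - Z. pencil_injective S' c" using S'(2,3) insert.prems(3)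
          by (metis Diff_iff insert_iff)
      qed (use S'(1) insert.prems(1) in auto)
    qed
  qed auto
  have "Z \<subseteq> U" "\<forall>c\<in>cball 0 r - Z. pencil_injective S0 c"
    using r(2) by (auto simp: Z_def U_def)
  from remove_all[OF Z this(1) S0 this(2)]
  obtain S where S: "left_inverse S T" "\<forall>c\<in>cball 0 r. pencil_injective S c" by blast
  show ?thesis
  proof (rule that[OF S(1)])
    fix c :: complex assume c: "cmod c \<le> r"
    then have "c \<in> U" using r by (simp add: U_def)
    from ind[OF S(1) this] obtain F where F: "finite_rank F" "invertible_op (\<lambda>x. x - c *\<^sub>C S x + F x)"
      by blast
    from F(2) obtain Q where Q: "bounded_clinear Q" "\<And>x. Q (x - c *\<^sub>C S x + F x) = x"
      "\<And>x. Q x - c *\<^sub>C S (Q x) + F (Q x) = x"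
      by (rule invertible_opE) blast
    note Fl = bounded_clinearD[OF finite_rank_bounded_clinear[OF F(1)]]
    have Sb: "bounded_clinear S" using S(1) by (simp add: left_inverse_def)
    note Sl = bounded_clinearD[OF Sb]
    have eq: "y - c *\<^sub>C S y + F y = x - c *\<^sub>C S x" if "y = x - Q (F x)" "y = Q (x - c *\<^sub>C S x)" for x y
      using Q(3)[of "x - c *\<^sub>C S x"] that(2) by simp
    have QF: "x - Q (F x) = Q (x - c *\<^sub>C S x)" for x
    proof -
      have "Q (x - c *\<^sub>C S x) + Q (F x) = x" using Q(2)[of x] by (simp only: bounded_clinearD(2)[OF Q(1)])
      then show ?thesis by (metis add_diff_cancel_right')
    qed
    \<comment> \<open>\<open>I - c S = (I - c S + F) (I - Q F)\<close>. Injectivity passes to the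
      second factor, a finite rank perturbation of the identity, where it implies
      invertibility.\<close>
    have "invertible_op (\<lambda>x. x - Q (F x))"
    proof (rule finite_rank_injective_imp_invertible[OF finite_rank_left[OF Q(1) F(1)]])
      fix x assume "x - Q (F x) = 0"
      then have "Q (x - c *\<^sub>C S x) = 0" by (simp only: QF)
      then have "x - c *\<^sub>C S x = 0" using Q(3)[of "x - c *\<^sub>C S x"] by (simp add: Sl(5) Fl(5))
      then show "x = 0" using S(2) c by (auto simp: pencil_injective_def)
    qed
    from invertible_op_compose[OF F(2) this]
    show "invertible_op (\<lambda>x. x - c *\<^sub>C S x)" using eq[OF refl QF] by simp
  qed
qed

section \<open>Spectral radii and reciprocals in the extended half-line\<close>

lemma divide_left_mono_ennreal:
  fixes a b c :: ennreal
  assumes "a \<le> b" shows "c / b \<le> c / a"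
proof -
  have "inverse b \<le> inverse a"
    using assms including ennreal.lifting by transfer (rule ereal_inverse_antimono)
  then show ?thesis by (simp add: divide_ennreal_def mult_left_mono)
qed

text \<open>\<open>S - c I = - c (I - (1 / c) S)\<close>, and \<open>|c| \<ge> 1 / r\<close> puts
  \<open>1 / c\<close> into the closed disc of radius \<open>r\<close>.\<close>

lemma spectral_radius_le_inverse:
  assumes S: "bounded_clinear S" and r: "0 < r"
    and inv: "\<And>c. cmod c \<le> r \<Longrightarrow> invertible_op (\<lambda>x. x - c *\<^sub>C S x)"
  shows "spectral_radius S \<le> ennreal (1 / r)"
  unfolding spectral_radius_def
proof (rule SUP_least)
  fix c assume c: "c \<in> spectrum S"
  have "cmod c < 1 / r"
  proof (rule ccontr)
    assume "\<not> cmod c < 1 / r"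
    then have le: "1 / r \<le> cmod c" by simp
    then have "c \<noteq> 0" using r by auto
    have "cmod (1 / c) \<le> r" using le r \<open>c \<noteq> 0\<close> by (simp add: norm_divide field_simps)
    then have "invertible_op (\<lambda>x. x - (1 / c) *\<^sub>C S x)" by (rule inv)
    then obtain R where R: "bounded_clinear R" "\<And>x. R (x - (1 / c) *\<^sub>C S x) = x"
      "\<And>x. R x - (1 / c) *\<^sub>C S (R x) = x" by (rule invertible_opE) blast
    have eq: "S x - c *\<^sub>C x = (- c) *\<^sub>C (x - (1 / c) *\<^sub>C S x)" for x
      using \<open>c \<noteq> 0\<close> by (simp add: complex_vector.scale_right_diff_distrib scaleC_scaleC scaleC_one)
    note Sl = bounded_clinearD[OF S]
    have "invertible_op (\<lambda>x. S x - c *\<^sub>C x)"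
    proof (rule invertible_opI)
      show "bounded_clinear (\<lambda>x. (- 1 / c) *\<^sub>C R x)" by (rule bounded_clinear_scale[OF R(1)])
      show "(- 1 / c) *\<^sub>C R (S x - c *\<^sub>C x) = x" for x
        unfolding eq bounded_clinearD(4)[OF R(1)] R(2) using \<open>c \<noteq> 0\<close> by (simp add: scaleC_scaleC scaleC_one)
      have "S ((- 1 / c) *\<^sub>C R x) - c *\<^sub>C (- 1 / c) *\<^sub>C R x
          = (- c) *\<^sub>C ((- 1 / c) *\<^sub>C R x - (1 / c) *\<^sub>C S ((- 1 / c) *\<^sub>C R x))" for x
        by (rule eq)
      moreover have "(- c) *\<^sub>C ((- 1 / c) *\<^sub>C R x - (1 / c) *\<^sub>C S ((- 1 / c) *\<^sub>C R x))
          = R x - (1 / c) *\<^sub>C S (R x)" for x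
        using \<open>c \<noteq> 0\<close> by (simp add: Sl complex_vector.scale_right_diff_distrib scaleC_scaleC scaleC_one)
      ultimately show "S ((- 1 / c) *\<^sub>C R x) - c *\<^sub>C (- 1 / c) *\<^sub>C R x = x" for x using R(3) by simp
    qed
    then show False using c by (simp add: spectrum_def)
  qed
  then show "ennreal (cmod c) \<le> ennreal (1 / r)" by (intro ennreal_leI) simp
qed

lemma left_invertible_of_spectral_radius:
  assumes S: "left_inverse S T" and c: "ennreal (cmod c) < 1 / spectral_radius S"
  shows "left_invertible (\<lambda>x. T x - c *\<^sub>C x)"
proof (cases "c = 0")
  case True
  then show ?thesis using S by (auto simp: left_invertible_iff)
next
  case False
  have Sb: "bounded_clinear S" "\<And>x. S (T x) = x" using S by (auto simp: left_inverse_def)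
  \<comment> \<open>Here \<open>c\<close> is nonzero; at \<open>0\<close> the quotient
    \<open>1 / c\<close> would be \<open>0\<close> by convention and carry no information.\<close>
  have "1 / c \<notin> spectrum S"
  proof
    assume "1 / c \<in> spectrum S"
    then have "ennreal (cmod (1 / c)) \<le> spectral_radius S"
      unfolding spectral_radius_def by (rule SUP_upper)
    then have "1 / spectral_radius S \<le> 1 / ennreal (cmod (1 / c))"
      by (intro divide_left_mono_ennreal)
    also have "\<dots> = ennreal (cmod c)"
      using False by (simp add: norm_divide divide_ennreal flip: ennreal_1)
    finally show False using c by simp
  qed
  then have "invertible_op (\<lambda>x. S x - (1 / c) *\<^sub>C x)" by (simp add: spectrum_def)
  then obtain R where R: "bounded_clinear R" "\<And>x. R (S x - (1 / c) *\<^sub>C x) = x"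
    by (rule invertible_opE) blast
  have "left_inverse (\<lambda>x. (- 1 / c) *\<^sub>C R (S x)) (\<lambda>x. T x - c *\<^sub>C x)"
    unfolding left_inverse_def
  proof (intro conjI allI)
    show "bounded_clinear (\<lambda>x. (- 1 / c) *\<^sub>C R (S x))"
      by (rule bounded_clinear_scale[OF bounded_clinear_compose[OF R(1) Sb(1)]])
    fix x
    have "S (T x - c *\<^sub>C x) = (- c) *\<^sub>C (S x - (1 / c) *\<^sub>C x)"
      using False by (simp add: bounded_clinearD[OF Sb(1)] Sb(2)
          complex_vector.scale_right_diff_distrib scaleC_scaleC scaleC_one)
    then show "(- 1 / c) *\<^sub>C R (S (T x - c *\<^sub>C x)) = x"
      using False by (simp only: bounded_clinearD(4)[OF R(1)] R(2)) (simp add: scaleC_scaleC scaleC_one)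
  qed
  then show ?thesis by (auto simp: left_invertible_iff)
qed

theorem corollary3p4:
  fixes T :: "'a::cbanach \<Rightarrow> 'a"
  assumes "bounded_clinear T"
    and "left_invertible T"
    and "fredholm T"
  shows "set_edist 0 (left_spectrum T)
    = (SUP S \<in> {S. bounded_clinear S \<and> S \<circ> T = id}. 1 / spectral_radius S)"
proof (rule antisym)
  have li: "{S. bounded_clinear S \<and> S \<circ> T = id} = {S. left_inverse S T}"
    by (auto simp: left_inverse_def fun_eq_iff)
  show "(SUP S \<in> {S. bounded_clinear S \<and> S \<circ> T = id}. 1 / spectral_radius S) \<le> set_edist 0 (left_spectrum T)"
    unfolding li set_edist_def
  proof (intro SUP_least INF_greatest)
    fix S c assume "S \<in> {S. left_inverse S T}" "c \<in> left_spectrum T"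
    then show "1 / spectral_radius S \<le> ennreal (dist 0 c)"
      using left_invertible_of_spectral_radius[of S T c]
      by (auto simp: left_spectrum_def left_resolvent_set_def not_less[symmetric])
  qed
  show "set_edist 0 (left_spectrum T) \<le> (SUP S \<in> {S. bounded_clinear S \<and> S \<circ> T = id}. 1 / spectral_radius S)"
    unfolding li
  \<comment> \<open>Passing to numbers below the distance covers an infinite distance too. The
    intermediate \<open>z\<close> leaves room between the radius \<open>r\<close> of the closed disc
    and the radius \<open>\<rho>\<close> on which \<open>T - c\<close> is left invertible.\<close>
  proof (rule dense_le)
    fix y assume y: "y < set_edist 0 (left_spectrum T)"
    then obtain z where z: "y < z" "z < set_edist 0 (left_spectrum T)" using dense by blast
    have "z < \<infinity>" using z(2) by (rule less_le_trans) simp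
    then obtain \<rho> where \<rho>: "z = ennreal \<rho>" "0 \<le> \<rho>" by (cases z) auto
    have "y < \<infinity>" using z(1) \<open>z < \<infinity>\<close> by (rule less_trans)
    then obtain r where r: "y = ennreal r" "0 \<le> r" by (cases y) auto
    show "y \<le> (SUP S \<in> {S. left_inverse S T}. 1 / spectral_radius S)"
    proof (cases "r = 0")
      case False
      have inv: "left_invertible (\<lambda>x. T x - c *\<^sub>C x)" if "cmod c < \<rho>" for c
      proof (rule ccontr)
        assume "\<not> left_invertible (\<lambda>x. T x - c *\<^sub>C x)"
        then have "c \<in> left_spectrum T" by (simp add: left_spectrum_def left_resolvent_set_def)
        then have "set_edist 0 (left_spectrum T) \<le> ennreal (dist 0 c)"
          unfolding set_edist_def by (rule INF_lower)
        also have "\<dots> \<le> ennreal \<rho>" using that by (intro ennreal_leI) simp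
        finally show False using z(2) \<rho>(1) by simp
      qed
      have "0 < r" "r < \<rho>" using False r z(1) \<rho> by (auto simp: ennreal_less_iff)
      then obtain S where S: "left_inverse S T" "\<And>c. cmod c \<le> r \<Longrightarrow> invertible_op (\<lambda>x. x - c *\<^sub>C S x)"
        using left_inverse_small_spectrum[OF assms(1,3) inv] by blast
      have "y = 1 / ennreal (1 / r)"
        using \<open>0 < r\<close> by (simp add: r(1) divide_ennreal flip: ennreal_1)
      also have "\<dots> \<le> 1 / spectral_radius S"
        using S by (intro divide_left_mono_ennreal spectral_radius_le_inverse[OF _ \<open>0 < r\<close> S(2)])
          (simp_all add: left_inverse_def)
      also have "\<dots> \<le> (SUP S \<in> {S. left_inverse S T}. 1 / spectral_radius S)"
        using S(1) by (intro SUP_upper) simp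
      finally show ?thesis .
    qed (simp add: r)
  qed
qed

end
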